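(* Let $d$ be prime, $n\ge1$, and $\rho$ an $n$-qudit state. Then $\vec\lambda_{\mathcal M(\rho)}\prec\vec\lambda_\rho$, where $\vec\lambda_\tau\in\mathbb R^{d^n}$ denotes the vector of eigenvalues of $\tau$ (with multiplicity). Consequently, for every Schur-concave function $f$ of the spectrum, $f(\rho)\le f(\mathcal M(\rho))$.
   Context: Fix a prime $d$ and $n\ge1$; $\mathcal H=\mathbb C^d$, $\chi(k)=e^{2\pi ik/d}$, $X|k\rangle=|k+1\rangle$, $Z|k\rangle=\chi(k)|k\rangle$. Weyl operators: $w(p,q)=\chi(-2^{-1}pq)Z^pX^q$ for odd $d$, $w(p,q)=i^{-pq}Z^pX^q$ for $d=2$, and $w(\vec p,\vec q)=\bigotimes_k w(p_k,q_k)$ for $(\vec p,\vec q)\in V^n=\mathbb Z_d^n\times\mathbb Z_d^n$. Characteristic function: $\Xi_\rho(\vec p,\vec q)=\mathrm{Tr}[\rho\,w(-\vec p,-\vec q)]$. The mean state $\mathcal M(\rho)$ is the operator with $\Xi_{\mathcal M(\rho)}(\vec x)=\Xi_\rho(\vec x)$ if $|\Xi_\rho(\vec x)|=1$ and $0$ otherwise. For probability vectors $\vec p,\vec q\in\mathbb R^m$, $\vec p\prec\vec q$ means $\sum_{i\le k}p_i^\downarrow\le\sum_{i\le k}q_i^\downarrow$ for all $k$, where $\downarrow$ denotes decreasing rearrangement. $f$ is Schur concave if $\vec p\prec\vec q$ implies $f(\vec p)\ge f(\vec q)$; for a state, $f(\rho):=f(\vec\lambda_\rho)$. *)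

theory Defs
  imports "Jordan_Normal_Form.Jordan_Normal_Form" "HOL-Computational_Algebra.Primes"
begin

definition chi :: "nat \<Rightarrow> int \<Rightarrow> complex" where
  "chi d x = exp (2 * of_real pi * \<i> * of_int x / of_nat d)"

(* phase factor of the single-qudit Weyl operator w(p,q), for p,q in {0..d-1}:
   d = 2: i^(-pq);  d odd: chi(-2^{-1} p q), with 2^{-1} = (d+1)/2 mod d *)
definition weyl_phase :: "nat \<Rightarrow> int \<Rightarrow> int \<Rightarrow> complex" where
  "weyl_phase d p q =
     (if d = 2 then (- \<i>) ^ nat (p * q)
      else chi d (- ((int d + 1) div 2) * p * q))"

(* matrix entry <j| w(p,q) |k> of the single-qudit Weyl operator,
   w(p,q) = phase * Z^p X^q, with Z^p X^q |k> = chi(p (k+q)) |k+q> *)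
definition weyl1 :: "nat \<Rightarrow> int \<Rightarrow> int \<Rightarrow> nat \<Rightarrow> nat \<Rightarrow> complex" where
  "weyl1 d p q j k =
     (if int j mod int d = (int k + q) mod int d
      then weyl_phase d (p mod int d) (q mod int d) * chi d (p * int j) else 0)"

(* k-th digit (base d) of the computational basis index i of (C^d)^{\<otimes> n} *)
definition digit :: "nat \<Rightarrow> nat \<Rightarrow> nat \<Rightarrow> nat" where
  "digit d i k = (i div d ^ k) mod d"

(* n-qudit Weyl operator w(p,q) = tensor_k w(p_k,q_k), as a d^n x d^n matrix;
   p, q : nat => int represent vectors in Z_d^n (only entries k < n matter, mod d) *)
definition weyl :: "nat \<Rightarrow> nat \<Rightarrow> (nat \<Rightarrow> int) \<Rightarrow> (nat \<Rightarrow> int) \<Rightarrow> complex mat" where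
  "weyl d n p q = mat (d ^ n) (d ^ n)
     (\<lambda>(a, b). \<Prod>k<n. weyl1 d (p k) (q k) (digit d a k) (digit d b k))"

definition mtrace :: "complex mat \<Rightarrow> complex" where
  "mtrace A = (\<Sum>i<dim_row A. A $$ (i, i))"

definition char_fun :: "nat \<Rightarrow> nat \<Rightarrow> complex mat \<Rightarrow> (nat \<Rightarrow> int) \<Rightarrow> (nat \<Rightarrow> int) \<Rightarrow> complex" where
  "char_fun d n \<rho> p q = mtrace (\<rho> * weyl d n (\<lambda>k. - p k) (\<lambda>k. - q k))"

definition mean_state :: "nat \<Rightarrow> nat \<Rightarrow> complex mat \<Rightarrow> complex mat" where
  "mean_state d n \<rho> = (THE M. M \<in> carrier_mat (d ^ n) (d ^ n) \<and>
     (\<forall>p q. char_fun d n M p q =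
        (if cmod (char_fun d n \<rho> p q) = 1 then char_fun d n \<rho> p q else 0)))"

definition is_state :: "nat \<Rightarrow> nat \<Rightarrow> complex mat \<Rightarrow> bool" where
  "is_state d n \<rho> \<longleftrightarrow> \<rho> \<in> carrier_mat (d ^ n) (d ^ n) \<and>
     (\<forall>i < d ^ n. \<forall>j < d ^ n. \<rho> $$ (i, j) = cnj (\<rho> $$ (j, i))) \<and>
     (\<forall>v :: nat \<Rightarrow> complex.
        let s = (\<Sum>i < d ^ n. \<Sum>j < d ^ n. cnj (v i) * \<rho> $$ (i, j) * v j)
        in Im s = 0 \<and> Re s \<ge> 0) \<and>
     mtrace \<rho> = 1"

definition spec_vec :: "complex mat \<Rightarrow> real list" where
  "spec_vec A = rev (sorted_list_of_multiset (image_mset Re (proots (char_poly A))))"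

definition prob_vec :: "real list \<Rightarrow> bool" where
  "prob_vec p \<longleftrightarrow> (\<forall>x \<in> set p. 0 \<le> x) \<and> sum_list p = 1"

definition decr :: "real list \<Rightarrow> real list" where
  "decr p = rev (sort p)"

definition majorized :: "real list \<Rightarrow> real list \<Rightarrow> bool" where
  "majorized p q \<longleftrightarrow> length p = length q \<and> prob_vec p \<and> prob_vec q \<and>
     (\<forall>k \<le> length p. sum_list (take k (decr p)) \<le> sum_list (take k (decr q)))"

definition schur_concave :: "nat \<Rightarrow> (real list \<Rightarrow> real) \<Rightarrow> bool" where
  "schur_concave m f \<longleftrightarrow>
     (\<forall>p q. length p = m \<longrightarrow> length q = m \<longrightarrow> majorized p q \<longrightarrow> f q \<le> f p)"

end

theory Submission
  imports Defs "Jordan_Normal_Form.Schur_Decomposition" "HOL-Number_Theory.Cong"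
begin

text \<open>
  Write \<open>N = d\<^sup>n\<close>, \<open>g x = Tr (\<rho> w(x))\<close> and \<open>S = {x. |g x| = 1}\<close>. For \<open>x \<in> S\<close> the equality case of
  the Cauchy--Schwarz inequality gives \<open>\<rho> w(x) = g x \<cdot> \<rho>\<close>. The mean state is
  \<open>M = N\<^sup>-\<^sup>1 \<Sum>x\<in>S. g x \<cdot> w(x)\<^sup>\<dagger>\<close>, so \<open>\<rho> M = c \<rho>\<close> with \<open>c = |S| / N\<close>; and since the Weyl operators
  multiply up to phases, \<open>M w(x) = g x \<cdot> M\<close> on \<open>S\<close> and \<open>M M = c M\<close>. Hence \<open>M\<close> has eigenvalue
  \<open>c = 1/r\<close> with multiplicity \<open>r\<close> and \<open>0\<close> otherwise, while \<open>\<rho> M = c \<rho>\<close> leaves \<open>\<rho>\<close> with at most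
  \<open>r\<close> nonzero eigenvalues. A flat probability vector of length \<open>r\<close> is majorized by every
  probability vector with at most \<open>r\<close> nonzero entries.
\<close>

section \<open>Spectra of quasi-idempotent matrices\<close>

lemma mtrace_mult:
  assumes "A \<in> carrier_mat n m" "B \<in> carrier_mat m n"
  shows "mtrace (A * B) = (\<Sum>i<n. \<Sum>j<m. A $$ (i, j) * B $$ (j, i))"
  using assms by (auto simp: mtrace_def scalar_prod_def atLeast0LessThan intro!: sum.cong)

lemma mtrace_commute:
  assumes "A \<in> carrier_mat n m" "B \<in> carrier_mat m n"
  shows "mtrace (A * B) = mtrace (B * A)"
  unfolding mtrace_mult[OF assms] mtrace_mult[OF assms(2,1)]
  by (subst sum.swap) (simp add: mult.commute)

lemma mtrace_smult: "A \<in> carrier_mat n n \<Longrightarrow> mtrace (c \<cdot>\<^sub>m A) = c * mtrace A"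
  by (simp add: mtrace_def sum_distrib_left)

lemma proots_linear_factors: "proots (\<Prod>a\<leftarrow>as. [:- a, 1:]) = mset (as :: 'a :: idom list)"
proof (induction as)
  case (Cons a as)
  have "(\<Prod>a\<leftarrow>as. [:- a, 1:]) \<noteq> 0" by (auto simp: prod_list_zero_iff)
  then have "proots ([:- a, 1:] * (\<Prod>a\<leftarrow>as. [:- a, 1:])) = proots [:- a, 1:] + mset as"
    by (subst proots_mult) (simp_all add: Cons.IH)
  then show ?case by simp
qed simp

text \<open>Any ordering of the characteristic roots again factors the characteristic polynomial,
  because the roots are unique as a multiset. The freedom of ordering matters later, where the zero
  eigenvalues have to come first on the diagonal.\<close>

lemma schur_decomposition_proots:
  fixes A :: "complex mat"
  assumes A: "A \<in> carrier_mat n n" and es: "mset es = proots (char_poly A)"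
  obtains B P Q where "similar_mat_wit A B P Q" "upper_triangular B" "diag_mat B = es"
proof -
  obtain as where as: "char_poly A = (\<Prod>a\<leftarrow>as. [:- a, 1:])"
    using char_poly_factorized[OF A] by blast
  then have "mset es = mset as" using es by (simp add: proots_linear_factors)
  then have "mset (map (\<lambda>a. [:- a, 1:]) es) = mset (map (\<lambda>a. [:- a, 1:]) as)" by simp
  then have "char_poly A = (\<Prod>a\<leftarrow>es. [:- a, 1:])"
    unfolding as by (metis prod_mset_prod_list)
  moreover obtain B P Q where "schur_decomposition A es = (B, P, Q)"
    by (cases "schur_decomposition A es") auto
  ultimately show thesis using schur_decomposition[OF A] that by blast
qed

lemma size_proots_char_poly:
  fixes A :: "complex mat"
  assumes "A \<in> carrier_mat n n"
  shows "size (proots (char_poly A)) = n"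
  using degree_monic_char_poly[OF assms] by (simp add: size_proots_complex)

lemma mem_proots_char_poly_iff:
  fixes A :: "complex mat"
  assumes "A \<in> carrier_mat n n"
  shows "e \<in># proots (char_poly A) \<longleftrightarrow> eigenvalue A e"
proof -
  have "char_poly A \<noteq> 0" using degree_monic_char_poly[OF assms] by auto
  then show ?thesis using eigenvalue_root_char_poly[OF assms] by simp
qed

text \<open>Cyclicity of the trace removes the change of basis of a Schur triangularization, and the
  diagonal of the triangular factor lists the roots.\<close>

lemma mtrace_eq_sum_proots:
  fixes A :: "complex mat"
  assumes A: "A \<in> carrier_mat n n"
  shows "mtrace A = sum_mset (proots (char_poly A))"
proof -
  obtain es where es: "mset es = proots (char_poly A)" using ex_mset by blast
  obtain B P Q where B: "similar_mat_wit A B P Q" "diag_mat B = es"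
    using schur_decomposition_proots[OF A es] by metis
  note w = similar_mat_witD2[OF A B(1)]
  have "mtrace A = mtrace ((P * B) * Q)" using w(3) by simp
  also have "\<dots> = mtrace (Q * (P * B))"
    using w by (intro mtrace_commute[of _ n n]) auto
  also have "Q * (P * B) = (Q * P) * B"
    using w by (metis assoc_mult_mat)
  also have "\<dots> = B" using w by simp
  also have "mtrace B = sum_list es"
    unfolding B(2)[symmetric] diag_mat_def mtrace_def
    by (simp add: interv_sum_list_conv_sum_set_nat atLeast0LessThan)
  finally show ?thesis using es by (metis sum_mset_sum_list)
qed

section \<open>The ordered spectral vector\<close>

lemma mset_spec_vec: "mset (spec_vec A) = image_mset Re (proots (char_poly A))"
  by (simp add: spec_vec_def)

lemma length_spec_vec: "A \<in> carrier_mat n n \<Longrightarrow> length (spec_vec A) = n"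
  by (simp only: size_mset[symmetric] mset_spec_vec size_image_mset size_proots_char_poly)

lemma sorted_rev_spec_vec: "sorted (rev (spec_vec A))"
  by (simp add: spec_vec_def)

lemma decr_spec_vec: "decr (spec_vec A) = spec_vec A"
proof -
  have "sort (spec_vec A) = rev (spec_vec A)"
    by (rule properties_for_sort) (simp_all add: sorted_rev_spec_vec)
  then show ?thesis by (simp add: decr_def)
qed

lemma sum_list_spec_vec:
  assumes A: "A \<in> carrier_mat n n"
  shows "sum_list (spec_vec A) = Re (mtrace A)"
proof -
  have Re_sum: "Re (sum_mset X) = sum_mset (image_mset Re X)" for X
    by (induction X) auto
  have "sum_list (spec_vec A) = sum_mset (image_mset Re (proots (char_poly A)))"
    unfolding mset_spec_vec[symmetric] by (simp only: sum_mset_sum_list)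
  then show ?thesis by (simp add: mtrace_eq_sum_proots[OF A] Re_sum)
qed

text \<open>Applying \<open>A\<close> twice to an eigenvector gives \<open>c * e = e * e\<close> on
  any nonzero coordinate.\<close>

lemma eigenvalue_quasi_idempotent:
  fixes A :: "complex mat"
  assumes A: "A \<in> carrier_mat n n" and AA: "A * A = c \<cdot>\<^sub>m A" and e: "eigenvalue A e"
  shows "e = 0 \<or> e = c"
proof -
  obtain v where v: "v \<in> carrier_vec n" "v \<noteq> 0\<^sub>v n" "A *\<^sub>v v = e \<cdot>\<^sub>v v"
    using e A by (auto simp: eigenvalue_def eigenvector_def)
  have "(A * A) *\<^sub>v v = A *\<^sub>v (A *\<^sub>v v)" using A v(1) by (intro assoc_mult_mat_vec) auto
  also have "\<dots> = e \<cdot>\<^sub>v (e \<cdot>\<^sub>v v)" using A v by (simp add: mult_mat_vec)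
  also have "(A * A) *\<^sub>v v = c \<cdot>\<^sub>v (A *\<^sub>v v)"
    unfolding AA using A v(1) by (intro eq_vecI) auto
  finally have eq: "c \<cdot>\<^sub>v (e \<cdot>\<^sub>v v) = e \<cdot>\<^sub>v (e \<cdot>\<^sub>v v)"
    using v(3) by simp
  obtain i where i: "i < n" "v $ i \<noteq> 0" using v(1,2)
    by (metis carrier_vecD eq_vecI index_zero_vec)
  have "(c \<cdot>\<^sub>v (e \<cdot>\<^sub>v v)) $ i = (e \<cdot>\<^sub>v (e \<cdot>\<^sub>v v)) $ i" using eq by simp
  then show ?thesis using i v(1) by auto
qed

text \<open>Only 0 and \<open>c\<close> can occur as roots, and the trace fixes the multiplicity
  \<open>r\<close> of \<open>c\<close>: the roots sum to \<open>r * c\<close>, which must be 1. This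
  makes the spectrum flat with value \<open>1/r\<close>.\<close>

lemma proots_quasi_idempotent:
  fixes A :: "complex mat"
  assumes A: "A \<in> carrier_mat n n" and AA: "A * A = c \<cdot>\<^sub>m A" and tr: "mtrace A = 1"
  obtains r where "r \<le> n" "of_nat r * c = 1"
    "proots (char_poly A) = replicate_mset (n - r) 0 + replicate_mset r c"
proof -
  define X where "X = proots (char_poly A)"
  have sub: "e = 0 \<or> e = c" if "e \<in># X" for e
    using that eigenvalue_quasi_idempotent[OF A AA] mem_proots_char_poly_iff[OF A]
    by (auto simp: X_def)
  have "Y = replicate_mset (size Y - count Y c) 0 + replicate_mset (count Y c) c"
    if "c \<noteq> 0" "\<forall>e\<in>#Y. e = 0 \<or> e = c" for Y
    using that(2)
  proof (induction Y)
    case (add y Y)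
    have "count Y c \<le> size Y" by (rule count_le_size)
    with add that(1) show ?case by (auto simp: Suc_diff_le)
  qed simp
  moreover have c: "c \<noteq> 0"
  proof
    assume "c = 0"
    then have "sum_mset X = 0" using sub by (intro sum_mset.neutral) auto
    then show False using tr by (simp add: X_def mtrace_eq_sum_proots[OF A])
  qed
  ultimately have X: "X = replicate_mset (n - count X c) 0 + replicate_mset (count X c) c"
    using sub size_proots_char_poly[OF A] by (auto simp: X_def)
  have "of_nat (count X c) * c = sum_mset X"
    by (subst (2) X) (simp add: sum_mset_replicate_mset)
  then have "of_nat (count X c) * c = 1"
    using tr by (simp add: X_def mtrace_eq_sum_proots[OF A])
  moreover have "count X c \<le> n" using count_le_size[of X c] size_proots_char_poly[OF A]
    by (simp add: X_def)
  ultimately show thesis using X that unfolding X_def by blast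
qed

lemma char_poly_zero_mat: "char_poly (0\<^sub>m m m :: complex mat) = [:0, 1:] ^ m"
proof -
  have "upper_triangular (0\<^sub>m m m :: complex mat)" by (auto simp: upper_triangular_def)
  then have "char_poly (0\<^sub>m m m :: complex mat) = (\<Prod>a\<leftarrow>replicate m (0::complex). [:- a, 1:])"
    by (subst char_poly_upper_triangular[of _ m]) auto
  then show ?thesis by (simp add: prod_list_replicate)
qed

text \<open>Such a matrix is block upper triangular with a zero block of size \<open>m\<close> in
  the upper left corner, so its characteristic polynomial contains the factor
  \<open>[:0, 1:] ^ m\<close>.\<close>

lemma proots_zero_columns:
  fixes R :: "complex mat"
  assumes R: "R \<in> carrier_mat n n" and m: "m \<le> n"
    and zero: "\<And>i j. i < n \<Longrightarrow> j < m \<Longrightarrow> R $$ (i, j) = 0"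
  shows "replicate_mset m 0 \<subseteq># proots (char_poly R)"
proof -
  define C where "C = mat m (n - m) (\<lambda>(i, j). R $$ (i, j + m))"
  define D where "D = mat (n - m) (n - m) (\<lambda>(i, j). R $$ (i + m, j + m))"
  have R_eq: "R = four_block_mat (0\<^sub>m m m) C (0\<^sub>m (n - m) m) D"
    using R m zero by (intro eq_matI) (auto simp: C_def D_def)
  have D: "D \<in> carrier_mat (n - m) (n - m)" by (simp add: D_def)
  have "char_poly R = char_poly (0\<^sub>m m m) * char_poly D"
    using char_poly_factorized[OF D] char_poly_factorized[of "0\<^sub>m m m" m]
    by (intro char_poly_0_block[OF R_eq]) (auto simp: C_def D_def)
  moreover have "char_poly R \<noteq> 0" using degree_monic_char_poly[OF R] by auto
  ultimately have "proots (char_poly R) = proots ([:0, 1:] ^ m) + proots (char_poly D)"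
    by (simp add: char_poly_zero_mat proots_mult)
  moreover have "proots ([:0, 1:] ^ m :: complex poly) = replicate_mset m 0"
    by (simp add: proots_power)
  ultimately show ?thesis by simp
qed

text \<open>In a Schur basis of \<open>A\<close> with the zero eigenvalues first, the relation
  \<open>R * A = c R\<close> forces the first \<open>n - r\<close> columns of the transformed
  \<open>R\<close> to vanish. This bounds the number of nonzero eigenvalues of \<open>R\<close> by
  \<open>r\<close>.\<close>

lemma proots_supported_on_quasi_idempotent:
  fixes A R :: "complex mat"
  assumes A: "A \<in> carrier_mat n n" and R: "R \<in> carrier_mat n n"
    and RA: "R * A = c \<cdot>\<^sub>m R" and c: "c \<noteq> 0" and r: "r \<le> n"
    and roots: "proots (char_poly A) = replicate_mset (n - r) 0 + replicate_mset r c"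
  shows "replicate_mset (n - r) 0 \<subseteq># proots (char_poly R)"
proof -
  have "mset (replicate (n - r) 0 @ replicate r c) = proots (char_poly A)"
    by (simp add: roots)
  then obtain B P Q where B: "similar_mat_wit A B P Q" "upper_triangular B"
      "diag_mat B = replicate (n - r) 0 @ replicate r c"
    using schur_decomposition_proots[OF A] by metis
  note w = similar_mat_witD2[OF A B(1)]
  note [simp] = assoc_mult_mat[of _ n n _ n _ n]
  define R' where "R' = Q * R * P"
  have R': "R' \<in> carrier_mat n n" using w R by (simp add: R'_def)
  have "R = P * R' * Q"
  proof -
    have "P * R' * Q = (P * Q) * R * (P * Q)" unfolding R'_def using w(4-7) R by simp
    then show ?thesis using w R by simp
  qed
  then have "similar_mat_wit R R' P Q" using w R R' by (intro similar_mat_witI) auto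
  then have cp: "char_poly R = char_poly R'"
    by (intro char_poly_similar) (auto simp: similar_mat_def)
  \<comment> \<open>Conjugation carries the relation between \<open>R\<close> and \<open>A\<close>
    over to \<open>R'\<close> and the triangular matrix \<open>B\<close>.\<close>
  have "R' * B = Q * R * (P * B * (Q * P))" unfolding R'_def using w(4-7) R by (simp add: w(2))
  also have "\<dots> = Q * (R * (P * B * Q)) * P" using w(4-7) R by simp
  also have "\<dots> = Q * (c \<cdot>\<^sub>m R) * P" using RA w(3) by simp
  also have "\<dots> = c \<cdot>\<^sub>m R'" unfolding R'_def using w(4-7) R
    by (simp add: mult_smult_distrib mult_smult_assoc_mat[of _ n n _ n])
  finally have RB: "R' * B = c \<cdot>\<^sub>m R'" .
  have diag: "B $$ (j, j) = 0" if "j < n - r" for j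
  proof -
    have "B $$ (j, j) = diag_mat B ! j" using that w(5) by (auto simp: diag_mat_def)
    then show ?thesis using that by (simp add: B(3) nth_append)
  qed
  \<comment> \<open>The columns vanish one after another: in entry \<open>(i, j)\<close> of
    \<open>R' * B\<close> the terms with \<open>k < j\<close> vanish by induction, the term
    \<open>k = j\<close> by the zero diagonal, and those with \<open>k > j\<close> by triangularity.
    What remains is \<open>c * R' $$ (i, j) = 0\<close>.\<close>
  have zero: "R' $$ (i, j) = 0" if "i < n" "j < n - r" for i j
    using that(2)
  proof (induction j rule: less_induct)
    case (less j)
    have "R' $$ (i, k) * B $$ (k, j) = 0" if "k < n" for k
    proof (cases k j rule: linorder_cases)
      case less': less
      then show ?thesis using less.IH[of k] less.prems by simp
    next
      case equal
      then show ?thesis using diag less.prems by simp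
    next
      case greater
      then show ?thesis using B(2) w(5) that by (auto simp: upper_triangular_def)
    qed
    then have "(R' * B) $$ (i, j) = 0"
      using \<open>i < n\<close> less.prems R' w(5) by (auto simp: scalar_prod_def intro!: sum.neutral)
    then show ?case using RB c \<open>i < n\<close> less.prems R' by auto
  qed
  show ?thesis unfolding cp by (rule proots_zero_columns[OF R' _ zero]) auto
qed

text \<open>In a decreasing list the mean of the first \<open>k\<close> entries is at least the mean
  of the first \<open>r\<close>. Clearing denominators lets \<open>k = 0\<close> and
  \<open>r = 0\<close> take part without exception.\<close>

lemma take_sum_ge_average:
  fixes xs :: "real list"
  assumes dec: "sorted (rev xs)" and k: "k \<le> r" and r: "r \<le> length xs"
  shows "real k * sum_list (take r xs) \<le> real r * sum_list (take k xs)"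
proof -
  have mono: "xs ! j \<le> xs ! i" if "i \<le> j" "j < length xs" for i j
    using dec that by (simp add: sorted_rev_nth_mono)
  have take_sum: "sum_list (take m xs) = (\<Sum>i<m. xs ! i)" if "m \<le> length xs" for m
    using that by (simp add: sum_list_sum_nth atLeast0LessThan min_absorb2)
  have split: "(\<Sum>i<r. xs ! i) = (\<Sum>i<k. xs ! i) + (\<Sum>i=k..<r. xs ! i)"
    using k by (metis atLeast0LessThan sum.atLeastLessThan_concat zero_le)
  show ?thesis
  proof (cases "k < r")
    case True
    \<comment> \<open>The entry \<open>xs ! k\<close> separates the two ranges: it bounds the
      entries from \<open>k\<close> on from above and the earlier ones from below.\<close>
    have up: "(\<Sum>i=k..<r. xs ! i) \<le> real (r - k) * xs ! k"
      using sum_bounded_above[of "{k..<r}" "\<lambda>i. xs ! i" "xs ! k"] mono r by auto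
    have low: "real k * xs ! k \<le> (\<Sum>i<k. xs ! i)"
      using sum_bounded_below[of "{..<k}" "xs ! k" "\<lambda>i. xs ! i"] mono r True by auto
    have "real k * (\<Sum>i=k..<r. xs ! i) \<le> real (r - k) * (real k * xs ! k)"
      using mult_left_mono[OF up, of "real k"] by (simp add: mult_ac)
    also have "\<dots> \<le> real (r - k) * (\<Sum>i<k. xs ! i)"
      using low by (intro mult_left_mono) auto
    finally show ?thesis
      using k r by (simp add: take_sum split of_nat_diff algebra_simps)
  qed (use k in simp)
qed

text \<open>The spectrum of \<open>A\<close> is \<open>r\<close> copies of \<open>1/r\<close> padded
  with zeros, and that of \<open>R\<close> has at most \<open>r\<close> nonzero entries. For
  \<open>k\<close> up to \<open>r\<close> the partial sums compare by averaging over the first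
  \<open>r\<close> entries; from \<open>r\<close> on both are 1.\<close>

lemma majorized_flat_spectrum:
  fixes A R :: "complex mat"
  assumes A: "A \<in> carrier_mat n n" and R: "R \<in> carrier_mat n n"
    and AA: "A * A = c \<cdot>\<^sub>m A" and RA: "R * A = c \<cdot>\<^sub>m R"
    and trA: "mtrace A = 1" and trR: "mtrace R = 1"
    and pos: "\<And>e. eigenvalue R e \<Longrightarrow> 0 \<le> Re e"
  shows "majorized (spec_vec A) (spec_vec R)"
proof -
  obtain r where r: "r \<le> n" "of_nat r * c = 1"
      and roots: "proots (char_poly A) = replicate_mset (n - r) 0 + replicate_mset r c"
    using proots_quasi_idempotent[OF A AA trA] by blast
  have r0: "r > 0" using r(2) by (auto intro: gr0I)
  then have c: "c = of_real (1 / real r)" using r(2) by (simp add: field_simps)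
  define p where "p = spec_vec A"
  define q where "q = spec_vec R"
  have len: "length p = n" "length q = n"
    using length_spec_vec[OF A] length_spec_vec[OF R] by (simp_all add: p_def q_def)
  have sum1: "sum_list p = 1" "sum_list q = 1"
    using sum_list_spec_vec[OF A] sum_list_spec_vec[OF R] trA trR by (simp_all add: p_def q_def)
  have "mset (rev p) = mset (replicate (n - r) 0 @ replicate r (1 / real r))"
    by (simp add: p_def mset_spec_vec roots c)
  moreover have "sorted (rev p)" by (simp add: p_def sorted_rev_spec_vec)
  moreover have "sorted (replicate (n - r) 0 @ replicate r (1 / real r))"
    by (auto simp: sorted_append)
  ultimately have "rev p = replicate (n - r) 0 @ replicate r (1 / real r)"
    by (metis properties_for_sort sorted_sort_id)
  then have p: "p = replicate r (1 / real r) @ replicate (n - r) 0"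
    by (metis rev_append rev_replicate rev_rev_ident)
  have q_nonneg: "0 \<le> x" if "x \<in> set q" for x
  proof -
    have "x \<in># mset q" using that by simp
    then show ?thesis unfolding q_def mset_spec_vec
      using pos mem_proots_char_poly_iff[OF R] by auto
  qed
  have dec: "sorted (rev q)" by (simp add: q_def sorted_rev_spec_vec)
  have tail: "q ! i = 0" if i: "r \<le> i" "i < n" for i
  proof (rule ccontr)
    \<comment> \<open>A nonzero entry is positive and makes all earlier entries positive, which
      leaves at most \<open>n - Suc i\<close> zeros. Since \<open>r \<le> i\<close>, this is fewer
      than the \<open>n - r\<close> zeros guaranteed for \<open>R\<close>.\<close>
    assume "q ! i \<noteq> 0"
    then have "q ! i > 0" using q_nonneg[of "q ! i"] i len by (auto simp: less_le)
    then have "q ! j > 0" if "j \<le> i" for j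
      using sorted_rev_nth_mono[OF dec that] i len by auto
    then have "{j. j < length q \<and> q ! j = 0} \<subseteq> {Suc i..<n}"
      using len by (auto simp: Suc_le_eq) (metis less_irrefl not_le_imp_less)
    then have "card {j. j < length q \<and> q ! j = 0} \<le> n - Suc i"
      by (metis card_atLeastLessThan card_mono finite_atLeastLessThan)
    moreover have "count (mset q) 0 = card {j. j < length q \<and> q ! j = 0}"
      by (simp add: count_mset count_list_eq_length_filter length_filter_conv_card eq_commute[of 0])
    moreover have "image_mset Re (replicate_mset (n - r) 0) \<subseteq># mset q"
      unfolding q_def mset_spec_vec
      by (intro image_mset_subseteq_mono
          proots_supported_on_quasi_idempotent[OF A R RA _ r(1) roots]) (use c r0 in auto)
    then have "n - r \<le> count (mset q) 0"
      using mset_subset_eq_count[of "replicate_mset (n - r) 0" "mset q" 0] by simp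
    ultimately show False using i by auto
  qed
  have full: "sum_list (take k q) = 1" if k: "r \<le> k" "k \<le> n" for k
  proof -
    have "sum_list (drop k q) = 0"
      using tail k len by (auto simp: sum_list_sum_nth intro!: sum.neutral)
    then show ?thesis using sum1(2) by (metis append_take_drop_id sum_list_append add.right_neutral)
  qed
  have "sum_list (take k p) \<le> sum_list (take k q)" if "k \<le> n" for k
  proof (cases "k \<le> r")
    case True
    have "sum_list (take k p) = real k / real r"
      using True by (simp add: p min_def sum_list_replicate)
    moreover have "real k \<le> real r * sum_list (take k q)"
      using take_sum_ge_average[OF dec True] full[of r] r(1) len by simp
    ultimately show ?thesis using r0 by (simp add: pos_divide_le_eq mult.commute)
  next
    case False
    then show ?thesis using that full[of k] r0
      by (simp add: p sum_list_replicate)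
  qed
  moreover have "prob_vec p" using sum1 r0 by (auto simp: prob_vec_def p)
  moreover have "prob_vec q" using sum1 q_nonneg by (simp add: prob_vec_def)
  ultimately show ?thesis unfolding majorized_def
    using len by (simp add: p_def q_def decr_spec_vec)
qed

section \<open>Density matrices and nice error bases\<close>

text \<open>Vectors are plain functions on indices here, matching the quantifier over
  \<open>v\<close> in \<open>is_state\<close>.\<close>

definition sesq :: "nat \<Rightarrow> complex mat \<Rightarrow> (nat \<Rightarrow> complex) \<Rightarrow> (nat \<Rightarrow> complex) \<Rightarrow> complex" where
  "sesq N A u v = (\<Sum>i<N. \<Sum>j<N. cnj (u i) * A $$ (i, j) * v j)"

text \<open>The dimension is an arbitrary \<open>N\<close> in place of \<open>d ^ n\<close>, so that
  the argument can be run over an abstract operator basis.\<close>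

definition density_mat :: "nat \<Rightarrow> complex mat \<Rightarrow> bool" where
  "density_mat N A \<longleftrightarrow> A \<in> carrier_mat N N \<and>
     (\<forall>i<N. \<forall>j<N. A $$ (i, j) = cnj (A $$ (j, i))) \<and>
     (\<forall>v. Im (sesq N A v v) = 0 \<and> Re (sesq N A v v) \<ge> 0) \<and> mtrace A = 1"

lemma is_state_iff_density_mat: "is_state d n A \<longleftrightarrow> density_mat (d ^ n) A"
  unfolding is_state_def density_mat_def sesq_def Let_def ..

lemma density_matD:
  assumes "density_mat N A"
  shows "A \<in> carrier_mat N N"
    and "\<lbrakk>i < N; j < N\<rbrakk> \<Longrightarrow> cnj (A $$ (j, i)) = A $$ (i, j)"
    and "Im (sesq N A v v) = 0" and "0 \<le> Re (sesq N A v v)" and "mtrace A = 1"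
proof -
  from assms show "A \<in> carrier_mat N N" "mtrace A = 1" "Im (sesq N A v v) = 0" "0 \<le> Re (sesq N A v v)"
    unfolding density_mat_def by blast+
  from assms have "\<forall>i<N. \<forall>j<N. A $$ (i, j) = cnj (A $$ (j, i))"
    unfolding density_mat_def by blast
  then show "\<lbrakk>i < N; j < N\<rbrakk> \<Longrightarrow> cnj (A $$ (j, i)) = A $$ (i, j)" by metis
qed

lemma sesq_add_left: "sesq N A (\<lambda>k. u k + u' k) v = sesq N A u v + sesq N A u' v"
  by (simp add: sesq_def algebra_simps sum.distrib)

lemma sesq_add_right: "sesq N A u (\<lambda>k. v k + v' k) = sesq N A u v + sesq N A u v'"
  by (simp add: sesq_def algebra_simps sum.distrib)

lemma sesq_scale_left: "sesq N A (\<lambda>k. t * u k) v = cnj t * sesq N A u v"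
  by (simp add: sesq_def algebra_simps sum_distrib_left)

lemma sesq_scale_right: "sesq N A u (\<lambda>k. t * v k) = t * sesq N A u v"
  by (simp add: sesq_def algebra_simps sum_distrib_left)

lemma sesq_unit_left:
  assumes "i < N"
  shows "sesq N A (\<lambda>k. of_bool (k = i)) v = (\<Sum>j<N. A $$ (i, j) * v j)"
proof -
  have "sesq N A (\<lambda>k. of_bool (k = i)) v = (\<Sum>k<N. if k = i then (\<Sum>j<N. A $$ (i, j) * v j) else 0)"
    unfolding sesq_def by (intro sum.cong) auto
  then show ?thesis using assms by (simp add: sum.delta)
qed

lemma density_mat_sesq_commute:
  assumes "density_mat N A"
  shows "sesq N A u v = cnj (sesq N A v u)"
proof -
  have "cnj (sesq N A v u) = (\<Sum>i<N. \<Sum>j<N. v i * cnj (A $$ (i, j)) * cnj (u j))"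
    by (simp add: sesq_def)
  also have "\<dots> = (\<Sum>j<N. \<Sum>i<N. v i * cnj (A $$ (i, j)) * cnj (u j))" by (rule sum.swap)
  also have "\<dots> = sesq N A u v"
    unfolding sesq_def
  proof (intro sum.cong refl)
    fix i j assume "i \<in> {..<N}" "j \<in> {..<N}"
    then have "cnj (A $$ (j, i)) = A $$ (i, j)" by (intro density_matD(2)[OF assms]) auto
    then show "v j * cnj (A $$ (j, i)) * cnj (u i) = cnj (u i) * A $$ (i, j) * v j" by simp
  qed
  finally show ?thesis by simp
qed

text \<open>A positive form that vanishes at \<open>v\<close> has \<open>v\<close> in its kernel.
  Otherwise some coordinate \<open>z\<close> of the image of \<open>v\<close> is nonzero, and moving
  along a suitable multiple of \<open>v\<close> from the unit vector \<open>?e\<close> makes the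
  form negative.\<close>

lemma density_mat_kernel:
  assumes A: "density_mat N A" and zero: "sesq N A v v = 0" and i: "i < N"
  shows "(\<Sum>j<N. A $$ (i, j) * v j) = 0"
proof (rule ccontr)
  let ?e = "\<lambda>k. of_bool (k = i)"
  define z where "z = sesq N A ?e v"
  assume "\<not> ?thesis"
  then have z0: "z \<noteq> 0" using sesq_unit_left[OF i] by (simp add: z_def)
  have zc: "sesq N A v ?e = cnj z"
    unfolding z_def by (rule density_mat_sesq_commute[OF A])
  \<comment> \<open>The choice of \<open>t\<close> makes \<open>t * z\<close> real and negative;
    \<open>s\<close> is scaled so that the cross terms are minus the diagonal entry minus 1, and the
    form takes the value -1.\<close>
  define s where "s = (Re (sesq N A ?e ?e) + 1) / (2 * (cmod z)\<^sup>2)"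
  define t where "t = - of_real s * cnj z"
  have "sesq N A (\<lambda>k. t * v k + ?e k) (\<lambda>k. t * v k + ?e k)
      = cnj t * cnj z + t * z + sesq N A ?e ?e"
    by (simp add: sesq_add_left sesq_add_right sesq_scale_left sesq_scale_right zero zc
        z_def[symmetric] algebra_simps)
  also have "cnj t * cnj z + t * z = - of_real (2 * s) * (z * cnj z)"
    by (simp add: t_def algebra_simps)
  also have "\<dots> = - of_real (2 * s * (cmod z)\<^sup>2)"
    unfolding complex_norm_square[symmetric] by simp
  also have "2 * s * (cmod z)\<^sup>2 = Re (sesq N A ?e ?e) + 1"
    using z0 by (simp add: s_def)
  finally have "Re (sesq N A (\<lambda>k. t * v k + ?e k) (\<lambda>k. t * v k + ?e k)) = - 1" by simp
  moreover have "Re (sesq N A (\<lambda>k. t * v k + ?e k) (\<lambda>k. t * v k + ?e k)) \<ge> 0"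
    by (rule density_matD(4)[OF A])
  ultimately show False by simp
qed

text \<open>At an eigenvector the form equals the eigenvalue times the squared norm
  \<open>w\<close>, which is positive.\<close>

lemma density_mat_eigenvalue_nonneg:
  assumes A: "density_mat N A" and e: "eigenvalue A e"
  shows "0 \<le> Re e"
proof -
  note carrier = density_matD(1)[OF A]
  obtain v where v: "v \<in> carrier_vec N" "v \<noteq> 0\<^sub>v N" "A *\<^sub>v v = e \<cdot>\<^sub>v v"
    using e carrier by (auto simp: eigenvalue_def eigenvector_def)
  have row: "(\<Sum>j<N. A $$ (i, j) * v $ j) = e * v $ i" if "i < N" for i
  proof -
    have "(A *\<^sub>v v) $ i = (e \<cdot>\<^sub>v v) $ i" using v by simp
    then show ?thesis using that carrier v(1) by (simp add: scalar_prod_def atLeast0LessThan)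
  qed
  define w where "w = (\<Sum>i<N. (cmod (v $ i))\<^sup>2)"
  obtain k where k: "k < N" "v $ k \<noteq> 0" using v(1,2)
    by (metis carrier_vecD eq_vecI index_zero_vec)
  then have "0 < w" unfolding w_def by (intro sum_pos2[of _ k]) auto
  have "sesq N A (($) v) (($) v) = (\<Sum>i<N. cnj (v $ i) * (\<Sum>j<N. A $$ (i, j) * v $ j))"
    by (simp add: sesq_def sum_distrib_left algebra_simps)
  also have "\<dots> = (\<Sum>i<N. e * of_real ((cmod (v $ i))\<^sup>2))"
    using row by (intro sum.cong refl) (simp add: complex_norm_square del: of_real_power)
  also have "\<dots> = e * of_real w" by (simp add: w_def sum_distrib_left)
  finally have "Re e * w = Re (sesq N A (($) v) (($) v))" by simp
  also have "\<dots> \<ge> 0" by (rule density_matD(4)[OF A])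
  finally show ?thesis using \<open>0 < w\<close> by (simp add: zero_le_mult_iff)
qed

section \<open>Adjoints and unitary matrices\<close>

lemma dim_mat_adjoint [simp]:
  "dim_row (mat_adjoint A) = dim_col A" "dim_col (mat_adjoint A) = dim_row A"
  by (simp_all add: mat_adjoint_def)

lemma mat_adjoint_carrier [simp]: "A \<in> carrier_mat n m \<Longrightarrow> mat_adjoint A \<in> carrier_mat m n"
  by (intro carrier_matI) auto

lemma index_mat_adjoint [simp]:
  fixes A :: "complex mat"
  shows "i < dim_col A \<Longrightarrow> j < dim_row A \<Longrightarrow> mat_adjoint A $$ (i, j) = cnj (A $$ (j, i))"
  by (simp add: mat_adjoint_def mat_of_rows_def)

lemma unitary_entries:
  fixes U :: "complex mat"
  assumes U: "U \<in> carrier_mat N N" "U * mat_adjoint U = 1\<^sub>m N" and ij: "i < N" "j < N"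
  shows "(\<Sum>k<N. U $$ (i, k) * cnj (U $$ (j, k))) = of_bool (i = j)"
proof -
  have "(U * mat_adjoint U) $$ (i, j) = (\<Sum>k<N. U $$ (i, k) * cnj (U $$ (j, k)))"
    using U(1) ij by (simp add: scalar_prod_def atLeast0LessThan)
  then have "(\<Sum>k<N. U $$ (i, k) * cnj (U $$ (j, k))) = (1\<^sub>m N :: complex mat) $$ (i, j)"
    by (simp only: U(2))
  then show ?thesis using ij by simp
qed

text \<open>The equality case of the Cauchy--Schwarz inequality for the form \<open>Tr (A X Y\<^sup>\<dagger>)\<close>:
  for \<open>\<xi> = Tr (A U)\<close> of modulus one, the expectation of \<open>(U - \<xi>) (U - \<xi>)\<^sup>\<dagger>\<close> vanishes.\<close>

lemma density_mat_unimodular_expectation: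
  assumes A: "density_mat N A" and U: "U \<in> carrier_mat N N" "U * mat_adjoint U = 1\<^sub>m N"
    and one: "cmod (mtrace (A * U)) = 1"
  shows "A * U = mtrace (A * U) \<cdot>\<^sub>m A"
proof -
  define \<xi> where "\<xi> = mtrace (A * U)"
  note carrier = density_matD(1)[OF A] and sq = density_matD(3,4)[OF A]
  have tr: "(\<Sum>i<N. A $$ (i, i)) = 1"
    using density_matD(5)[OF A] carrier by (simp add: mtrace_def)
  have \<xi>1: "\<xi> * cnj \<xi> = 1" using one by (simp add: \<xi>_def complex_norm_square[symmetric])
  have \<xi>_sum: "\<xi> = (\<Sum>i<N. \<Sum>j<N. A $$ (i, j) * U $$ (j, i))"
    unfolding \<xi>_def by (rule mtrace_mult[OF carrier U(1)])
  have "cnj \<xi> = (\<Sum>i<N. \<Sum>j<N. cnj (A $$ (i, j)) * cnj (U $$ (j, i)))"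
    by (simp add: \<xi>_sum)
  also have "\<dots> = (\<Sum>j<N. \<Sum>i<N. cnj (A $$ (i, j)) * cnj (U $$ (j, i)))" by (rule sum.swap)
  also have "\<dots> = (\<Sum>i<N. \<Sum>j<N. A $$ (i, j) * cnj (U $$ (i, j)))"
    by (intro sum.cong refl) (simp add: density_matD(2)[OF A])
  finally have \<xi>_cnj: "(\<Sum>i<N. \<Sum>j<N. A $$ (i, j) * cnj (U $$ (i, j))) = cnj \<xi>" ..
  \<comment> \<open>The vector \<open>a k\<close> is the \<open>k\<close>-th column of
    \<open>U - \<xi>\<close>. Summing the form over all columns gives the trace of \<open>A\<close>
    times \<open>(U - \<xi>)\<close> times its adjoint.\<close>
  define a where "a k j = U $$ (j, k) - \<xi> * of_bool (j = k)" for k j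
  \<comment> \<open>These are the entries of \<open>(U - \<xi>)\<close> times its adjoint; the 2
    collects the identity from unitarity of \<open>U\<close> and the one from \<open>\<xi>\<close>
    having modulus one.\<close>
  have aa: "(\<Sum>k<N. a k j * cnj (a k i)) =
      2 * of_bool (i = j) - cnj \<xi> * U $$ (j, i) - \<xi> * cnj (U $$ (i, j))"
    if "i < N" "j < N" for i j
  proof -
    have "(\<Sum>k<N. a k j * cnj (a k i)) = (\<Sum>k<N. U $$ (j, k) * cnj (U $$ (i, k))
        - cnj \<xi> * (if k = i then U $$ (j, i) else 0) - \<xi> * (if k = j then cnj (U $$ (i, j)) else 0)
        + \<xi> * cnj \<xi> * (if k = i then of_bool (i = j) else 0))"
      by (intro sum.cong) (auto simp: a_def algebra_simps)
    also have "\<dots> = of_bool (j = i) - cnj \<xi> * U $$ (j, i) - \<xi> * cnj (U $$ (i, j))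
        + \<xi> * cnj \<xi> * of_bool (i = j)"
      using that unitary_entries[OF U that(2,1)]
      by (simp add: sum.distrib sum_subtractf sum_distrib_left[symmetric])
    finally show ?thesis using \<xi>1 by auto
  qed
  have "(\<Sum>k<N. sesq N A (a k) (a k)) = (\<Sum>k<N. \<Sum>i<N. \<Sum>j<N. A $$ (i, j) * (a k j * cnj (a k i)))"
    by (simp add: sesq_def mult_ac)
  also have "\<dots> = (\<Sum>i<N. \<Sum>k<N. \<Sum>j<N. A $$ (i, j) * (a k j * cnj (a k i)))"
    by (rule sum.swap)
  also have "\<dots> = (\<Sum>i<N. \<Sum>j<N. \<Sum>k<N. A $$ (i, j) * (a k j * cnj (a k i)))"
    by (intro sum.cong refl sum.swap)
  also have "\<dots> = (\<Sum>i<N. \<Sum>j<N. A $$ (i, j) *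
      (2 * of_bool (i = j) - cnj \<xi> * U $$ (j, i) - \<xi> * cnj (U $$ (i, j))))"
    using aa by (intro sum.cong refl) (simp add: sum_distrib_left[symmetric])
  also have "\<dots> = 2 * (\<Sum>i<N. \<Sum>j<N. if j = i then A $$ (i, i) else 0)
      - cnj \<xi> * (\<Sum>i<N. \<Sum>j<N. A $$ (i, j) * U $$ (j, i))
      - \<xi> * (\<Sum>i<N. \<Sum>j<N. A $$ (i, j) * cnj (U $$ (i, j)))"
    unfolding sum_distrib_left sum_subtractf[symmetric]
    by (intro sum.cong refl) (auto simp: algebra_simps)
  also have "\<dots> = 0"
    using tr \<xi>1 by (simp add: \<xi>_sum[symmetric] \<xi>_cnj mult.commute)
  finally have total: "(\<Sum>k<N. Re (sesq N A (a k) (a k))) = 0"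
    by (metis Re_sum zero_complex.simps(1))
  \<comment> \<open>Nonnegative terms with sum zero vanish one by one, so \<open>A\<close>
    annihilates each column of \<open>U - \<xi>\<close>.\<close>
  have "Re (sesq N A (a k) (a k)) = 0" if "k < N" for k
    using total that sq by (simp add: sum_nonneg_eq_0_iff)
  then have ker: "sesq N A (a k) (a k) = 0" if "k < N" for k
    using that sq by (simp add: complex_eq_iff)
  show ?thesis
  proof (rule eq_matI)
    fix i k assume "i < dim_row (mtrace (A * U) \<cdot>\<^sub>m A)" "k < dim_col (mtrace (A * U) \<cdot>\<^sub>m A)"
    then have ik: "i < N" "k < N" using carrier by auto
    have "0 = (\<Sum>j<N. A $$ (i, j) * a k j)"
      using density_mat_kernel[OF A ker ik(1)] ik by simp
    also have "\<dots> = (\<Sum>j<N. A $$ (i, j) * U $$ (j, k)) - (\<Sum>j<N. if j = k then \<xi> * A $$ (i, k) else 0)"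
      unfolding sum_subtractf[symmetric] by (intro sum.cong) (auto simp: a_def algebra_simps)
    also have "\<dots> = (\<Sum>j<N. A $$ (i, j) * U $$ (j, k)) - \<xi> * A $$ (i, k)" using ik by simp
    finally show "(A * U) $$ (i, k) = (mtrace (A * U) \<cdot>\<^sub>m A) $$ (i, k)"
      using ik carrier U(1) by (simp add: \<xi>_def[symmetric] scalar_prod_def atLeast0LessThan)
  qed (use carrier U in auto)
qed

text \<open>These are the properties of the Weyl operators from which the result follows: finitely
  many orthogonal unitaries that determine a matrix by its traces, closed under multiplication up to
  phases. The index set needs no group structure, since \<open>product\<close> only asserts that a
  suitable index exists.\<close>

locale nice_error_basis =
  fixes N :: nat and X :: "'x set" and W :: "'x \<Rightarrow> complex mat"
  assumes finite_X: "finite X" and N_pos: "N > 0"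
    and W_carrier: "x \<in> X \<Longrightarrow> W x \<in> carrier_mat N N"
    and unitary: "x \<in> X \<Longrightarrow> W x * mat_adjoint (W x) = 1\<^sub>m N"
    and orthogonal: "\<lbrakk>x \<in> X; y \<in> X\<rbrakk> \<Longrightarrow>
      (\<Sum>a<N. \<Sum>b<N. cnj (W x $$ (b, a)) * W y $$ (b, a)) = (if x = y then of_nat N else 0)"
    and separating: "\<lbrakk>A \<in> carrier_mat N N; B \<in> carrier_mat N N;
      \<And>x. x \<in> X \<Longrightarrow> mtrace (A * W x) = mtrace (B * W x)\<rbrakk> \<Longrightarrow> A = B"
    and product: "\<lbrakk>x \<in> X; y \<in> X\<rbrakk> \<Longrightarrow> \<exists>z\<in>X. \<exists>\<omega>. cmod \<omega> = 1 \<and> W x * W y = \<omega> \<cdot>\<^sub>m W z"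
    and one: "\<exists>x\<in>X. W x = 1\<^sub>m N"
begin

text \<open>This is the sum of \<open>f x\<close> times the adjoint of \<open>W x\<close>. With the
  adjoint, orthogonality lets the trace against \<open>W y\<close> read off the coefficient
  \<open>f y\<close>.\<close>

definition expand :: "('x \<Rightarrow> complex) \<Rightarrow> complex mat" where
  "expand f = mat N N (\<lambda>(i, j). \<Sum>x\<in>X. f x * cnj (W x $$ (j, i)))"

lemma expand_carrier [simp]: "expand f \<in> carrier_mat N N"
  by (simp add: expand_def)

lemma mult_expand_index:
  assumes A: "A \<in> carrier_mat N N" and ij: "i < N" "j < N"
  shows "(A * expand f) $$ (i, j) = (\<Sum>x\<in>X. f x * (A * mat_adjoint (W x)) $$ (i, j))"
proof -
  have "(A * expand f) $$ (i, j) = (\<Sum>k<N. \<Sum>x\<in>X. A $$ (i, k) * (f x * cnj (W x $$ (j, k))))"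
    using A ij by (simp add: scalar_prod_def atLeast0LessThan expand_def sum_distrib_left)
  also have "\<dots> = (\<Sum>x\<in>X. \<Sum>k<N. A $$ (i, k) * (f x * cnj (W x $$ (j, k))))" by (rule sum.swap)
  also have "\<dots> = (\<Sum>x\<in>X. f x * (A * mat_adjoint (W x)) $$ (i, j))"
  proof (rule sum.cong[OF refl])
    fix x assume "x \<in> X"
    from W_carrier[OF this] show "(\<Sum>k<N. A $$ (i, k) * (f x * cnj (W x $$ (j, k)))) =
        f x * (A * mat_adjoint (W x)) $$ (i, j)"
      using A ij by (simp add: scalar_prod_def atLeast0LessThan sum_distrib_left mult_ac)
  qed
  finally show ?thesis .
qed

lemma mtrace_expand:
  assumes y: "y \<in> X"
  shows "mtrace (expand f * W y) = of_nat N * f y"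
proof -
  have "mtrace (expand f * W y) = (\<Sum>i<N. \<Sum>j<N. \<Sum>x\<in>X. f x * (cnj (W x $$ (j, i)) * W y $$ (j, i)))"
    by (subst mtrace_mult[OF expand_carrier W_carrier[OF y]])
       (simp add: expand_def sum_distrib_left mult_ac)
  also have "\<dots> = (\<Sum>i<N. \<Sum>x\<in>X. \<Sum>j<N. f x * (cnj (W x $$ (j, i)) * W y $$ (j, i)))"
    by (intro sum.cong refl sum.swap)
  also have "\<dots> = (\<Sum>x\<in>X. \<Sum>i<N. \<Sum>j<N. f x * (cnj (W x $$ (j, i)) * W y $$ (j, i)))"
    by (rule sum.swap)
  also have "\<dots> = (\<Sum>x\<in>X. f x * (if x = y then of_nat N else 0))"
    using y by (intro sum.cong refl) (simp add: sum_distrib_left[symmetric] orthogonal)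
  also have "\<dots> = (\<Sum>x\<in>X. if x = y then of_nat N * f y else 0)"
    by (intro sum.cong) auto
  finally show ?thesis using y finite_X by simp
qed

section \<open>The stabilizer and the mean of a state\<close>

definition stabilizer :: "complex mat \<Rightarrow> 'x set" where
  "stabilizer \<rho> = {x \<in> X. cmod (mtrace (\<rho> * W x)) = 1}"

definition mean :: "complex mat \<Rightarrow> complex mat" where
  "mean \<rho> = expand (\<lambda>x. if x \<in> stabilizer \<rho> then mtrace (\<rho> * W x) / of_nat N else 0)"

lemma mean_carrier [simp]: "mean \<rho> \<in> carrier_mat N N"
  by (simp add: mean_def)

lemma mtrace_mean:
  "x \<in> X \<Longrightarrow> mtrace (mean \<rho> * W x) = (if cmod (mtrace (\<rho> * W x)) = 1 then mtrace (\<rho> * W x) else 0)"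
  using N_pos by (simp add: mean_def mtrace_expand stabilizer_def)

text \<open>By unitarity the eigenvalue relation for \<open>W x\<close> turns into \<open>A\<close>
  being \<open>mtrace (\<rho> * W x)\<close> times \<open>A\<close> times the adjoint of
  \<open>W x\<close>. Each stabilizer element therefore contributes \<open>A / N\<close> to the
  product. Used both for \<open>A = \<rho>\<close> and for the mean itself, with the same
  constant.\<close>

lemma mult_mean:
  assumes A: "A \<in> carrier_mat N N"
    and stab: "\<And>x. x \<in> stabilizer \<rho> \<Longrightarrow> A * W x = mtrace (\<rho> * W x) \<cdot>\<^sub>m A"
  shows "A * mean \<rho> = (of_nat (card (stabilizer \<rho>)) / of_nat N) \<cdot>\<^sub>m A"
proof (rule eq_matI)
  let ?S = "stabilizer \<rho>" and ?g = "\<lambda>x. mtrace (\<rho> * W x)"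
  fix i j assume "i < dim_row ((of_nat (card ?S) / of_nat N) \<cdot>\<^sub>m A)"
    "j < dim_col ((of_nat (card ?S) / of_nat N) \<cdot>\<^sub>m A)"
  then have ij: "i < N" "j < N" using A by auto
  have absorb: "?g x * (A * mat_adjoint (W x)) $$ (i, j) = A $$ (i, j)" if x: "x \<in> ?S" for x
  proof -
    have W: "W x \<in> carrier_mat N N" "W x * mat_adjoint (W x) = 1\<^sub>m N"
      using x by (auto simp: stabilizer_def W_carrier unitary)
    have "A = A * (W x * mat_adjoint (W x))" using A W by simp
    also have "\<dots> = (A * W x) * mat_adjoint (W x)"
      by (rule assoc_mult_mat[symmetric]) (use A W in auto)
    also have "\<dots> = ?g x \<cdot>\<^sub>m (A * mat_adjoint (W x))"
      unfolding stab[OF x] by (rule mult_smult_assoc_mat) (use A W in auto)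
    finally have "A $$ (i, j) = (?g x \<cdot>\<^sub>m (A * mat_adjoint (W x))) $$ (i, j)" by simp
    then show ?thesis using A W ij by simp
  qed
  have "(A * mean \<rho>) $$ (i, j) = (\<Sum>x\<in>X. if x \<in> ?S then A $$ (i, j) / of_nat N else 0)"
    unfolding mean_def mult_expand_index[OF A ij] using absorb by (intro sum.cong) auto
  also have "\<dots> = (\<Sum>x\<in>?S. A $$ (i, j) / of_nat N)"
    using finite_X by (subst sum.inter_filter[symmetric]) (auto simp: stabilizer_def intro: sum.cong)
  finally show "(A * mean \<rho>) $$ (i, j) = ((of_nat (card ?S) / of_nat N) \<cdot>\<^sub>m A) $$ (i, j)"
    using A ij by simp
qed (simp_all add: carrier_matD[OF A] carrier_matD[OF mean_carrier])

context
  fixes \<rho> :: "complex mat"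
  assumes \<rho>: "density_mat N \<rho>"
begin

lemmas \<rho>_carrier = density_matD(1)[OF \<rho>]

lemma stabilizer_state:
  assumes "x \<in> stabilizer \<rho>"
  shows "\<rho> * W x = mtrace (\<rho> * W x) \<cdot>\<^sub>m \<rho>"
proof -
  have x: "x \<in> X" "cmod (mtrace (\<rho> * W x)) = 1" using assms by (simp_all add: stabilizer_def)
  show ?thesis
    by (rule density_mat_unimodular_expectation[OF \<rho> W_carrier[OF x(1)] unitary[OF x(1)] x(2)])
qed

text \<open>Multiplication by \<open>W y\<close> sends \<open>W x\<close> to a phase times some
  \<open>W z\<close>, where \<open>x\<close> and \<open>z\<close> are both in the stabilizer or both
  outside. Hence cutting off the expectations outside the stabilizer respects the relation that
  \<open>\<rho>\<close> satisfies.\<close>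

lemma stabilizer_mean:
  assumes y: "y \<in> stabilizer \<rho>"
  shows "mean \<rho> * W y = mtrace (\<rho> * W y) \<cdot>\<^sub>m mean \<rho>"
proof (rule separating)
  let ?g = "\<lambda>x. mtrace (\<rho> * W x)"
  have yX: "y \<in> X" and gy: "cmod (?g y) = 1" using y by (auto simp: stabilizer_def)
  note Wy = W_carrier[OF yX]
  show "mean \<rho> * W y \<in> carrier_mat N N" "?g y \<cdot>\<^sub>m mean \<rho> \<in> carrier_mat N N"
    using mult_carrier_mat[OF mean_carrier Wy] by auto
  fix x assume x: "x \<in> X"
  note Wx = W_carrier[OF x]
  obtain z \<omega> where z: "z \<in> X" "cmod \<omega> = 1" "W y * W x = \<omega> \<cdot>\<^sub>m W z"
    using product[OF yX x] by blast
  note Wz = W_carrier[OF z(1)]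
  have trans: "mtrace (A * W y * W x) = \<omega> * mtrace (A * W z)" if A: "A \<in> carrier_mat N N" for A
  proof -
    have "A * W y * W x = A * (W y * W x)" by (rule assoc_mult_mat) (use A Wy Wx in auto)
    also have "\<dots> = \<omega> \<cdot>\<^sub>m (A * W z)" unfolding z by (rule mult_smult_distrib) (use A Wz in auto)
    finally show ?thesis using A Wz by (simp add: mtrace_smult[of _ N])
  qed
  \<comment> \<open>For the state itself the two ways of evaluating this product relate the
    expectations at \<open>x\<close>, \<open>y\<close> and \<open>z\<close>.\<close>
  have "\<rho> * W y * W x = ?g y \<cdot>\<^sub>m (\<rho> * W x)"
    by (subst stabilizer_state[OF y], rule mult_smult_assoc_mat) (use \<rho>_carrier Wx in auto)
  then have eq: "\<omega> * ?g z = ?g y * ?g x"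
    using trans[OF \<rho>_carrier] \<rho>_carrier Wx by (simp add: mtrace_smult[of _ N])
  then have "cmod (\<omega> * ?g z) = cmod (?g y * ?g x)" by simp
  then have "cmod (?g z) = cmod (?g x)" using z(2) gy by (simp add: norm_mult)
  \<comment> \<open>Equal moduli mean that the case distinction in \<open>mtrace_mean\<close> falls
    the same way for \<open>x\<close> and \<open>z\<close>: either both values are kept and
    \<open>eq\<close> applies, or both are 0.\<close>
  then have "\<omega> * mtrace (mean \<rho> * W z) = ?g y * mtrace (mean \<rho> * W x)"
    using eq by (simp add: mtrace_mean x z(1))
  moreover have "mtrace (?g y \<cdot>\<^sub>m mean \<rho> * W x) = ?g y * mtrace (mean \<rho> * W x)"
  proof -
    have "?g y \<cdot>\<^sub>m mean \<rho> * W x = ?g y \<cdot>\<^sub>m (mean \<rho> * W x)"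
      by (rule mult_smult_assoc_mat[OF mean_carrier Wx])
    then show ?thesis using mtrace_smult[OF mult_carrier_mat[OF mean_carrier Wx]] by simp
  qed
  ultimately show "mtrace (mean \<rho> * W y * W x) = mtrace (?g y \<cdot>\<^sub>m mean \<rho> * W x)"
    by (simp add: trans)
qed

text \<open>The identity belongs to the basis, and its expectation 1 has modulus one, so the mean
  keeps it.\<close>

lemma mtrace_mean_one: "mtrace (mean \<rho>) = 1"
proof -
  obtain x where x: "x \<in> X" "W x = 1\<^sub>m N" using one by blast
  show ?thesis
    using density_matD(5)[OF \<rho>] mtrace_mean[OF x(1), of \<rho>] \<rho>_carrier
    by (simp add: x(2) right_mult_one_mat[OF \<rho>_carrier] right_mult_one_mat[OF mean_carrier])
qed

theorem majorized_mean: "majorized (spec_vec (mean \<rho>)) (spec_vec \<rho>)"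
proof (rule majorized_flat_spectrum)
  show "mean \<rho> * mean \<rho> = (of_nat (card (stabilizer \<rho>)) / of_nat N) \<cdot>\<^sub>m mean \<rho>"
    using stabilizer_mean by (rule mult_mean[OF mean_carrier])
  show "\<rho> * mean \<rho> = (of_nat (card (stabilizer \<rho>)) / of_nat N) \<cdot>\<^sub>m \<rho>"
    using stabilizer_state by (rule mult_mean[OF \<rho>_carrier])
  show "0 \<le> Re e" if "eigenvalue \<rho> e" for e
    using \<rho> that by (rule density_mat_eigenvalue_nonneg)
qed (rule mean_carrier \<rho>_carrier mtrace_mean_one density_matD(5)[OF \<rho>])+

end

end

section \<open>The Weyl operators\<close>

lemma digit_less: "d > 0 \<Longrightarrow> digit d a k < d"
  by (simp add: digit_def)

lemma digit_add_high:
  assumes "k < n"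
  shows "digit d (j * d ^ n + b) k = digit d b k"
proof (cases "d = 0")
  case False
  have "d ^ n = d ^ (n - Suc k) * d ^ Suc k"
    using assms by (metis Suc_leI le_add_diff_inverse2 power_add)
  then have split: "j * d ^ n = (j * d ^ (n - Suc k) * d) * d ^ k" by (simp add: mult_ac)
  have "(j * d ^ n + b) div d ^ k = j * d ^ (n - Suc k) * d + b div d ^ k"
    unfolding split using False by simp
  then show ?thesis by (simp add: digit_def)
qed (use assms in \<open>simp add: digit_def power_0_left\<close>)

lemma digit_top: "b < d ^ n \<Longrightarrow> j < d \<Longrightarrow> digit d (j * d ^ n + b) n = j"
  by (simp add: digit_def)

lemma sum_lessThan_power_Suc:
  fixes f :: "nat \<Rightarrow> 'a :: comm_monoid_add"
  shows "(\<Sum>a<d ^ Suc n. f a) = (\<Sum>j<d. \<Sum>b<d ^ n. f (j * d ^ n + b))"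
proof -
  have "(\<Sum>j<d. sum f {j * d ^ n..<j * d ^ n + d ^ n}) = (\<Sum>a<d * d ^ n. f a)"
    by (rule sum.nat_group)
  moreover have "sum f {j * d ^ n..<j * d ^ n + d ^ n} = (\<Sum>b<d ^ n. f (j * d ^ n + b))" for j
    using sum.shift_bounds_nat_ivl[of f 0 "j * d ^ n" "d ^ n"]
    by (simp add: atLeast0LessThan add.commute)
  ultimately show ?thesis by simp
qed

text \<open>The digits of \<open>a\<close> run through all \<open>n\<close>-tuples, so this is
  distributivity, obtained by splitting off the leading digit. It reduces identities for tensor
  products to identities for single factors.\<close>

lemma sum_prod_digits:
  fixes F :: "nat \<Rightarrow> nat \<Rightarrow> complex"
  shows "(\<Sum>a<d ^ n. \<Prod>k<n. F k (digit d a k)) = (\<Prod>k<n. \<Sum>j<d. F k j)"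
proof (induction n)
  case (Suc n)
  have "(\<Sum>a<d ^ Suc n. \<Prod>k<Suc n. F k (digit d a k)) =
      (\<Sum>j<d. \<Sum>b<d ^ n. (\<Prod>k<n. F k (digit d b k)) * F n j)"
    unfolding sum_lessThan_power_Suc
    by (intro sum.cong refl) (simp add: digit_add_high digit_top)
  also have "\<dots> = (\<Prod>k<n. \<Sum>j<d. F k j) * (\<Sum>j<d. F n j)"
    by (simp add: sum_distrib_right[symmetric] Suc.IH sum_distrib_left[symmetric])
  finally show ?case by simp
qed simp

lemma sum_prod_digits2:
  fixes F :: "nat \<Rightarrow> nat \<Rightarrow> nat \<Rightarrow> complex"
  shows "(\<Sum>a<d ^ n. \<Sum>b<d ^ n. \<Prod>k<n. F k (digit d a k) (digit d b k)) =
    (\<Prod>k<n. \<Sum>i<d. \<Sum>j<d. F k i j)"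
proof -
  have "(\<Sum>b<d ^ n. \<Prod>k<n. F k (digit d a k) (digit d b k)) =
      (\<Prod>k<n. \<Sum>j<d. F k (digit d a k) j)" for a
    by (rule sum_prod_digits)
  then show ?thesis using sum_prod_digits[where F = "\<lambda>k i. \<Sum>j<d. F k i j"] by simp
qed

lemma digit_surj:
  assumes "\<And>k. k < n \<Longrightarrow> f k < d"
  shows "\<exists>a<d ^ n. \<forall>k<n. digit d a k = f k"
  using assms
proof (induction n)
  case (Suc n)
  then obtain a where a: "a < d ^ n" "\<forall>k<n. digit d a k = f k" by force
  have "f n < d" using Suc.prems by simp
  have "f n * d ^ n + a < d ^ Suc n"
  proof -
    have "f n * d ^ n + a < Suc (f n) * d ^ n" using a(1) by simp
    also have "\<dots> \<le> d * d ^ n" using \<open>f n < d\<close> by (intro mult_right_mono) auto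
    finally show ?thesis by simp
  qed
  moreover have "digit d (f n * d ^ n + a) k = f k" if "k < Suc n" for k
    using that a digit_add_high[of k n d "f n" a] digit_top[OF a(1) \<open>f n < d\<close>]
    by (auto simp: less_Suc_eq)
  ultimately show ?case by blast
qed simp

lemma digit_inject:
  assumes "a < d ^ n" "b < d ^ n" "\<And>k. k < n \<Longrightarrow> digit d a k = digit d b k"
  shows "a = b"
  using assms
proof (induction n arbitrary: a b)
  case (Suc n)
  have d: "d > 0" using Suc.prems(1) by (cases "d = 0") auto
  have low: "digit d (c mod d ^ n) k = digit d c k" if "k < n" for c k
    using digit_add_high[OF that, of d "c div d ^ n" "c mod d ^ n"]
    by (simp only: div_mult_mod_eq)
  have top: "digit d c n = c div d ^ n" if "c < d ^ Suc n" for c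
    using that d by (simp add: digit_def less_mult_imp_div_less)
  have "a mod d ^ n = b mod d ^ n"
  proof (rule Suc.IH)
    show "digit d (a mod d ^ n) k = digit d (b mod d ^ n) k" if "k < n" for k
      unfolding low[OF that] using that by (intro Suc.prems(3)) simp
  qed (use d in simp_all)
  moreover have "a div d ^ n = b div d ^ n"
    unfolding top[OF Suc.prems(1), symmetric] top[OF Suc.prems(2), symmetric]
    by (rule Suc.prems(3)) simp
  ultimately show ?case by (metis div_mult_mod_eq)
qed simp

lemma digit_eq_iff:
  "a < d ^ n \<Longrightarrow> b < d ^ n \<Longrightarrow> (\<forall>k<n. digit d a k = digit d b k) \<longleftrightarrow> a = b"
  by (auto intro: digit_inject)

lemma prod_of_bool: "(\<Prod>k<(n::nat). of_bool (P k) :: complex) = of_bool (\<forall>k<n. P k)"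
  by (induction n) (auto simp: less_Suc_eq)

section \<open>The additive character \<open>chi\<close>\<close>

lemma chi_add: "chi d (x + y) = chi d x * chi d y"
  by (simp add: chi_def exp_add[symmetric] add_divide_distrib algebra_simps)

lemma chi_0 [simp]: "chi d 0 = 1"
  by (simp add: chi_def)

lemma chi_eq_cis: "chi d x = cis (2 * pi * of_int x / of_nat d)"
  by (simp add: chi_def cis_conv_exp mult_ac)

lemma cmod_chi [simp]: "cmod (chi d x) = 1"
  by (simp add: chi_eq_cis)

lemma cnj_chi: "cnj (chi d x) = chi d (- x)"
  by (simp add: chi_eq_cis cis_cnj)

lemma chi_mult_nat: "chi d (x * int k) = chi d x ^ k"
  by (induction k) (simp_all add: chi_add algebra_simps)

lemma chi_eq_1_iff:
  assumes "d > 0"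
  shows "chi d x = 1 \<longleftrightarrow> int d dvd x"
proof -
  have "chi d x = 1 \<longleftrightarrow> cos (2 * pi * of_int x / of_nat d) = 1"
    by (auto simp: chi_eq_cis complex_eq_iff cos_one_sin_zero)
  also have "\<dots> \<longleftrightarrow> (\<exists>n::int. 2 * pi * of_int x / of_nat d = of_int n * 2 * pi)"
    by (rule cos_one_2pi_int)
  also have "\<dots> \<longleftrightarrow> (\<exists>n::int. x = int d * n)"
  proof (rule iff_exI)
    fix n :: int
    have "2 * pi * of_int x / of_nat d = of_int n * 2 * pi \<longleftrightarrow> real_of_int x = of_int (int d * n)"
      using assms by (simp add: field_simps)
    then show "2 * pi * of_int x / of_nat d = of_int n * 2 * pi \<longleftrightarrow> x = int d * n"
      by (simp only: of_int_eq_iff)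
  qed
  finally show ?thesis by (simp add: dvd_def)
qed

lemma chi_cong:
  assumes "d > 0" "[x = y] (mod int d)"
  shows "chi d x = chi d y"
proof -
  have "chi d (x - y) = 1" using assms by (simp add: chi_eq_1_iff cong_iff_dvd_diff)
  then show ?thesis using chi_add[of d "x - y" y] by simp
qed

text \<open>Unless \<open>d\<close> divides \<open>x\<close>, this is a full geometric sum over a
  nontrivial \<open>d\<close>-th root of unity.\<close>

lemma sum_chi:
  assumes "d > 0"
  shows "(\<Sum>k<d. chi d (x * int k)) = of_nat d * of_bool (int d dvd x)"
proof (cases "int d dvd x")
  case True
  then show ?thesis using assms chi_eq_1_iff[OF assms, of x] by (simp add: chi_mult_nat)
next
  case False
  then have "chi d x \<noteq> 1" using chi_eq_1_iff[OF assms] by simp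
  moreover have "chi d x ^ d = 1"
    using chi_eq_1_iff[OF assms, of "x * int d"] by (simp add: chi_mult_nat)
  ultimately show ?thesis using False by (simp add: chi_mult_nat geometric_sum)
qed

lemma dvd_int_diff_iff:
  "a < d \<Longrightarrow> b < d \<Longrightarrow> int d dvd int a - int b \<longleftrightarrow> a = b"
  unfolding cong_iff_dvd_diff[symmetric] cong_int_iff by (simp add: cong_def)

section \<open>Single-qudit Weyl operators\<close>

lemma cmod_weyl_phase [simp]: "cmod (weyl_phase d p q) = 1"
  by (simp add: weyl_phase_def norm_power)

text \<open>The column of the only nonzero entry in row \<open>j\<close> of the single-qudit \<open>w(p, q)\<close>.\<close>

definition weyl_src :: "nat \<Rightarrow> int \<Rightarrow> nat \<Rightarrow> nat" where
  "weyl_src d q j = nat ((int j - q) mod int d)"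

context
  fixes d :: nat
  assumes d: "d > 0"
begin

lemma int_weyl_src: "int (weyl_src d q j) = (int j - q) mod int d"
  using d by (simp add: weyl_src_def)

lemma weyl_src_less: "weyl_src d q j < d"
  using d by (simp add: weyl_src_def nat_less_iff)

lemma eq_weyl_src_iff:
  assumes "l < d"
  shows "l = weyl_src d q j \<longleftrightarrow> [int j = int l + q] (mod int d)"
proof -
  have "l = weyl_src d q j \<longleftrightarrow> int l mod int d = (int j - q) mod int d"
    using assms by (metis int_weyl_src mod_pos_pos_trivial of_nat_0_le_iff of_nat_eq_iff of_nat_less_iff)
  also have "\<dots> \<longleftrightarrow> int d dvd int j - (int l + q)"
    by (subst mod_eq_dvd_iff, subst dvd_minus_iff[symmetric]) (simp add: algebra_simps)
  finally show ?thesis by (simp add: cong_iff_dvd_diff)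
qed

text \<open>Each row has a single nonzero entry. In this form every sum over a column index
  collapses to one term.\<close>

lemma weyl1_eq:
  assumes "l < d"
  shows "weyl1 d p q j l =
    of_bool (l = weyl_src d q j) * weyl_phase d (p mod int d) (q mod int d) * chi d (p * int j)"
  using eq_weyl_src_iff[OF assms, of q j] by (simp add: weyl1_def cong_def)

lemma weyl_src_inject:
  assumes "j < d" "j' < d"
  shows "weyl_src d q j = weyl_src d q j' \<longleftrightarrow> j = j'"
proof -
  have "weyl_src d q j = weyl_src d q j' \<longleftrightarrow> (int j - q) mod int d = (int j' - q) mod int d"
    by (metis int_weyl_src of_nat_eq_iff)
  also have "\<dots> \<longleftrightarrow> int d dvd int j - int j'" by (simp add: mod_eq_dvd_iff)
  finally show ?thesis using assms by (simp add: dvd_int_diff_iff)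
qed

lemma weyl_src_inject_shift:
  assumes "q < d" "q' < d"
  shows "weyl_src d (int q) j = weyl_src d (int q') j \<longleftrightarrow> q = q'"
proof -
  have "weyl_src d (int q) j = weyl_src d (int q') j \<longleftrightarrow> (int j - int q) mod int d = (int j - int q') mod int d"
    by (metis int_weyl_src of_nat_eq_iff)
  also have "\<dots> \<longleftrightarrow> int d dvd int q' - int q" by (simp add: mod_eq_dvd_iff)
  finally show ?thesis using assms by (auto simp: dvd_int_diff_iff)
qed

text \<open>By this cancellation the phase conventions for \<open>d = 2\<close> and for odd
  \<open>d\<close> need not be told apart in the sums below.\<close>

lemma weyl_phase_cnj [simp]: "weyl_phase d p q * cnj (weyl_phase d p q) = 1"
  by (simp add: complex_norm_square[symmetric])

lemma weyl1_unitary: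
  assumes "j < d" "j' < d"
  shows "(\<Sum>l<d. weyl1 d p q j l * cnj (weyl1 d p q j' l)) = of_bool (j = j')"
proof -
  let ?w = "weyl_phase d (p mod int d) (q mod int d)"
  have "(\<Sum>l<d. weyl1 d p q j l * cnj (weyl1 d p q j' l)) =
      (\<Sum>l<d. if l = weyl_src d q j then of_bool (j = j') * (?w * cnj ?w) * (chi d (p * int j) * cnj (chi d (p * int j))) else 0)"
    using weyl_src_inject[OF assms, of q] by (intro sum.cong refl) (auto simp: weyl1_eq)
  then show ?thesis using weyl_src_less by (simp add: cnj_chi chi_add[symmetric])
qed

text \<open>Only one shift \<open>q\<close> links column \<open>l\<close> to row \<open>j\<close>;
  the sum over \<open>p\<close> is then a character sum that forces \<open>j = j'\<close>, and equal
  rows with equal shift have equal columns.\<close>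

lemma weyl1_complete:
  assumes "j < d" "j' < d" "l < d" "l' < d"
  shows "(\<Sum>p<d. \<Sum>q<d. weyl1 d (int p) (int q) j l * cnj (weyl1 d (int p) (int q) j' l')) =
    of_nat d * of_bool (j = j' \<and> l = l')"
proof -
  let ?w = "\<lambda>p q. weyl_phase d (int p mod int d) (int q mod int d)"
  \<comment> \<open>The shift from \<open>l\<close> to \<open>j\<close> is \<open>j - l\<close>
    modulo \<open>d\<close>, which is \<open>weyl_src\<close> with the roles of shift and column
    exchanged.\<close>
  define r where "r = weyl_src d (int l) j"
  have r: "r < d" by (simp add: r_def weyl_src_less)
  have q_iff: "l = weyl_src d (int q) j \<longleftrightarrow> q = r" if "q < d" for q
    using eq_weyl_src_iff[OF assms(3), of "int q" j] eq_weyl_src_iff[OF that, of "int l" j]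
    by (simp add: r_def add.commute)
  have "(\<Sum>p<d. \<Sum>q<d. weyl1 d (int p) (int q) j l * cnj (weyl1 d (int p) (int q) j' l')) =
      (\<Sum>p<d. \<Sum>q<d. (?w p q * cnj (?w p q)) * (if q = r then of_bool (l' = weyl_src d (int q) j')
        * chi d ((int j - int j') * int p) else 0))"
    using assms(3,4)
    by (intro sum.cong refl)
       (auto simp: weyl1_eq q_iff cnj_chi chi_add[symmetric] algebra_simps)
  also have "\<dots> = (\<Sum>p<d. of_bool (l' = weyl_src d (int r) j') * chi d ((int j - int j') * int p))"
    using r by simp
  also have "\<dots> = of_bool (l' = weyl_src d (int r) j') * (of_nat d * of_bool (j = j'))"
    using assms d by (simp only: sum_distrib_left[symmetric] sum_chi[OF d] dvd_int_diff_iff)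
  also have "\<dots> = of_nat d * of_bool (j = j' \<and> l = l')"
    using q_iff[OF r] by auto
  finally show ?thesis .
qed

text \<open>Different shifts have disjoint supports. For equal shifts the character sum over the
  rows separates \<open>p\<close> from \<open>p'\<close>.\<close>

lemma weyl1_orthogonal:
  assumes "p < d" "q < d" "p' < d" "q' < d"
  shows "(\<Sum>a<d. \<Sum>b<d. cnj (weyl1 d (int p) (int q) b a) * weyl1 d (int p') (int q') b a) =
    of_nat d * of_bool (p = p' \<and> q = q')"
proof -
  let ?w = "\<lambda>p q. weyl_phase d (int p mod int d) (int q mod int d)"
  let ?c = "of_bool (q = q') * (cnj (?w p q) * ?w p' q')"
  have "(\<Sum>a<d. \<Sum>b<d. cnj (weyl1 d (int p) (int q) b a) * weyl1 d (int p') (int q') b a) =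
      (\<Sum>b<d. \<Sum>a<d. cnj (weyl1 d (int p) (int q) b a) * weyl1 d (int p') (int q') b a)"
    by (rule sum.swap)
  also have "\<dots> = (\<Sum>b<d. \<Sum>a<d. if a = weyl_src d (int q) b
      then ?c * chi d ((int p' - int p) * int b) else 0)"
    using weyl_src_inject_shift[OF assms(2,4)]
    by (intro sum.cong refl) (auto simp: weyl1_eq cnj_chi chi_add[symmetric] algebra_simps)
  also have "\<dots> = (\<Sum>b<d. ?c * chi d ((int p' - int p) * int b))"
    using weyl_src_less by simp
  also have "\<dots> = ?c * (of_nat d * of_bool (p' = p))"
    using assms d by (simp only: sum_distrib_left[symmetric] sum_chi[OF d] dvd_int_diff_iff)
  also have "\<dots> = of_nat d * of_bool (p = p' \<and> q = q')"
    by (auto simp: mult.commute)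
  finally show ?thesis .
qed

lemma weyl1_mult:
  obtains \<omega> where "cmod \<omega> = 1"
    "\<And>j m. m < d \<Longrightarrow> (\<Sum>l<d. weyl1 d p q j l * weyl1 d p' q' l m) = \<omega> * weyl1 d (p + p') (q + q') j m"
proof
  let ?w = "\<lambda>p q. weyl_phase d (p mod int d) (q mod int d)"
  \<comment> \<open>Moving the shift by \<open>q\<close> past the clock power \<open>p'\<close>
    costs \<open>chi d (- (p' * q))\<close>. The remaining factors trade the phases of the two
    operators for that of their product.\<close>
  let ?\<omega> = "?w p q * ?w p' q' * chi d (- (p' * q)) / ?w (p + p') (q + q')"
  show "cmod ?\<omega> = 1" by (simp add: norm_mult norm_divide)
  have nz: "?w (p + p') (q + q') \<noteq> 0" using cmod_weyl_phase by (metis norm_zero zero_neq_one)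
  fix j m assume m: "m < d"
  have comp: "weyl_src d q' (weyl_src d q j) = weyl_src d (q + q') j"
    by (simp add: weyl_src_def[of d q'] int_weyl_src mod_diff_left_eq)
       (simp add: weyl_src_def algebra_simps)
  have src: "chi d (p' * int (weyl_src d q j)) = chi d (p' * (int j - q))"
    using d by (intro chi_cong) (simp_all add: int_weyl_src cong_def mod_mult_right_eq)
  have "(\<Sum>l<d. weyl1 d p q j l * weyl1 d p' q' l m) =
      (\<Sum>l<d. if l = weyl_src d q j then ?w p q * chi d (p * int j) * weyl1 d p' q' l m else 0)"
    by (intro sum.cong refl) (auto simp: weyl1_eq)
  also have "\<dots> = ?w p q * chi d (p * int j) * weyl1 d p' q' (weyl_src d q j) m"
    using weyl_src_less by simp
  also have "\<dots> = of_bool (m = weyl_src d (q + q') j) * (?w p q * ?w p' q') *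
      (chi d (p * int j) * chi d (p' * (int j - q)))"
    using m by (simp add: weyl1_eq comp src)
  also have "chi d (p * int j) * chi d (p' * (int j - q)) = chi d (- (p' * q)) * chi d ((p + p') * int j)"
    by (simp add: chi_add[symmetric] algebra_simps)
  finally show "(\<Sum>l<d. weyl1 d p q j l * weyl1 d p' q' l m) = ?\<omega> * weyl1 d (p + p') (q + q') j m"
    using m nz by (simp add: weyl1_eq)
qed

lemma weyl1_0:
  assumes "j < d" "l < d"
  shows "weyl1 d 0 0 j l = of_bool (j = l)"
  using assms by (simp add: weyl1_def weyl_phase_def)

text \<open>The phase already sees reduced arguments, and \<open>chi\<close> has period
  \<open>d\<close>. This allows digits to represent arbitrary integer coordinates.\<close>

lemma weyl1_mod: "weyl1 d (p mod int d) (q mod int d) j l = weyl1 d p q j l"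
proof -
  have "chi d (p mod int d * int j) = chi d (p * int j)"
    using d by (intro chi_cong) (simp_all add: cong_def mod_mult_left_eq)
  then show ?thesis by (simp add: weyl1_def mod_add_right_eq)
qed

section \<open>Weyl operators on \<open>n\<close> qudits\<close>

lemma weyl_carrier [simp]: "weyl d n p q \<in> carrier_mat (d ^ n) (d ^ n)"
  by (simp add: weyl_def)

lemma dim_weyl [simp]: "dim_row (weyl d n p q) = d ^ n" "dim_col (weyl d n p q) = d ^ n"
  by (simp_all add: weyl_def)

lemma index_weyl:
  "a < d ^ n \<Longrightarrow> b < d ^ n \<Longrightarrow>
    weyl d n p q $$ (a, b) = (\<Prod>k<n. weyl1 d (p k) (q k) (digit d a k) (digit d b k))"
  by (simp add: weyl_def)

text \<open>Infinitely many coordinate functions give the same operator. Encoding a phase space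
  point by two numbers below \<open>d ^ n\<close>, whose digits are the coordinates, yields a finite
  index set without repetitions.\<close>

definition basis_weyl :: "nat \<Rightarrow> nat \<times> nat \<Rightarrow> complex mat" where
  "basis_weyl n = (\<lambda>(P, Q). weyl d n (\<lambda>k. int (digit d P k)) (\<lambda>k. int (digit d Q k)))"

lemma basis_weyl_carrier [simp]: "basis_weyl n x \<in> carrier_mat (d ^ n) (d ^ n)"
  by (simp add: basis_weyl_def split: prod.split)

lemma weyl_in_basis: "\<exists>x\<in>{..<d ^ n} \<times> {..<d ^ n}. weyl d n p q = basis_weyl n x"
proof -
  have "nat (f k mod int d) < d" for f :: "nat \<Rightarrow> int" and k
    using d by (simp add: nat_less_iff)
  then have "\<exists>P<d ^ n. \<forall>k<n. digit d P k = nat (f k mod int d)" for f :: "nat \<Rightarrow> int"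
    by (intro digit_surj)
  then obtain P Q where PQ: "P < d ^ n" "\<forall>k<n. digit d P k = nat (p k mod int d)"
      "Q < d ^ n" "\<forall>k<n. digit d Q k = nat (q k mod int d)"
    by metis
  have "weyl d n p q = basis_weyl n (P, Q)"
    unfolding basis_weyl_def prod.case
  proof (rule eq_matI)
    fix a b assume "a < dim_row (weyl d n (\<lambda>k. int (digit d P k)) (\<lambda>k. int (digit d Q k)))"
      "b < dim_col (weyl d n (\<lambda>k. int (digit d P k)) (\<lambda>k. int (digit d Q k)))"
    then have "a < d ^ n" "b < d ^ n" by auto
    then show "weyl d n p q $$ (a, b) =
        weyl d n (\<lambda>k. int (digit d P k)) (\<lambda>k. int (digit d Q k)) $$ (a, b)"
      using PQ(2,4) d by (auto simp: index_weyl weyl1_mod intro!: prod.cong)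
  qed auto
  then show ?thesis using PQ(1,3) by blast
qed

lemma weyl_unitary: "weyl d n p q * mat_adjoint (weyl d n p q) = 1\<^sub>m (d ^ n)"
proof (rule eq_matI)
  fix a b assume "a < dim_row (1\<^sub>m (d ^ n) :: complex mat)" "b < dim_col (1\<^sub>m (d ^ n) :: complex mat)"
  then have ab: "a < d ^ n" "b < d ^ n" by auto
  have "(weyl d n p q * mat_adjoint (weyl d n p q)) $$ (a, b) =
      (\<Sum>c<d ^ n. \<Prod>k<n. weyl1 d (p k) (q k) (digit d a k) (digit d c k) *
        cnj (weyl1 d (p k) (q k) (digit d b k) (digit d c k)))"
    using ab by (simp add: scalar_prod_def atLeast0LessThan index_weyl prod.distrib)
  also have "\<dots> = (\<Prod>k<n. \<Sum>l<d. weyl1 d (p k) (q k) (digit d a k) l *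
      cnj (weyl1 d (p k) (q k) (digit d b k) l))"
    by (rule sum_prod_digits)
  also have "\<dots> = (\<Prod>k<n. of_bool (digit d a k = digit d b k))"
    using d by (simp only: weyl1_unitary digit_less)
  also have "\<dots> = of_bool (a = b)" using ab by (simp add: prod_of_bool digit_eq_iff)
  finally show "(weyl d n p q * mat_adjoint (weyl d n p q)) $$ (a, b) = 1\<^sub>m (d ^ n) $$ (a, b)"
    using ab by simp
qed auto

text \<open>The phases of the single factors do not depend on the matrix indices, so they can be
  pulled out and multiplied.\<close>

lemma weyl_mult:
  "\<exists>\<omega>. cmod \<omega> = 1 \<and> weyl d n p q * weyl d n p' q' = \<omega> \<cdot>\<^sub>m weyl d n (\<lambda>k. p k + p' k) (\<lambda>k. q k + q' k)"
proof -
  have "\<exists>\<omega>. cmod \<omega> = 1 \<and> (\<forall>j m. m < d \<longrightarrow> (\<Sum>l<d. weyl1 d (p k) (q k) j l * weyl1 d (p' k) (q' k) l m) =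
      \<omega> * weyl1 d (p k + p' k) (q k + q' k) j m)" for k
    by (rule weyl1_mult[of "p k" "q k" "p' k" "q' k"]) blast
  then obtain \<omega> where \<omega>: "cmod (\<omega> k) = 1"
      "\<And>j m. m < d \<Longrightarrow> (\<Sum>l<d. weyl1 d (p k) (q k) j l * weyl1 d (p' k) (q' k) l m) =
        \<omega> k * weyl1 d (p k + p' k) (q k + q' k) j m" for k
    by metis
  have "weyl d n p q * weyl d n p' q' = (\<Prod>k<n. \<omega> k) \<cdot>\<^sub>m weyl d n (\<lambda>k. p k + p' k) (\<lambda>k. q k + q' k)"
    (is "_ = ?R")
  proof (rule eq_matI)
    fix a b assume "a < dim_row ?R" "b < dim_col ?R"
    then have ab: "a < d ^ n" "b < d ^ n" by auto
    have "(weyl d n p q * weyl d n p' q') $$ (a, b) =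
        (\<Sum>c<d ^ n. \<Prod>k<n. weyl1 d (p k) (q k) (digit d a k) (digit d c k) *
          weyl1 d (p' k) (q' k) (digit d c k) (digit d b k))"
      using ab by (simp add: scalar_prod_def atLeast0LessThan index_weyl prod.distrib)
    also have "\<dots> = (\<Prod>k<n. \<Sum>l<d. weyl1 d (p k) (q k) (digit d a k) l *
        weyl1 d (p' k) (q' k) l (digit d b k))"
      by (rule sum_prod_digits)
    also have "\<dots> = (\<Prod>k<n. \<omega> k * weyl1 d (p k + p' k) (q k + q' k) (digit d a k) (digit d b k))"
      using d by (simp only: \<omega> digit_less)
    finally show "(weyl d n p q * weyl d n p' q') $$ (a, b) = ?R $$ (a, b)"
      using ab by (simp add: index_weyl prod.distrib)
  qed auto
  moreover have "cmod (\<Prod>k<n. \<omega> k) = 1" by (simp add: prod_norm[symmetric] \<omega>(1))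
  ultimately show ?thesis by blast
qed

lemma weyl_0: "weyl d n (\<lambda>_. 0) (\<lambda>_. 0) = 1\<^sub>m (d ^ n)"
proof (rule eq_matI)
  fix a b assume "a < dim_row (1\<^sub>m (d ^ n) :: complex mat)" "b < dim_col (1\<^sub>m (d ^ n) :: complex mat)"
  then have ab: "a < d ^ n" "b < d ^ n" by auto
  have "weyl d n (\<lambda>_. 0) (\<lambda>_. 0) $$ (a, b) = (\<Prod>k<n. of_bool (digit d a k = digit d b k))"
    using ab d by (simp add: index_weyl weyl1_0 digit_less)
  then show "weyl d n (\<lambda>_. 0) (\<lambda>_. 0) $$ (a, b) = 1\<^sub>m (d ^ n) $$ (a, b)"
    using ab by (simp add: prod_of_bool digit_eq_iff)
qed auto

lemma basis_weyl_orthogonal: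
  assumes "x \<in> {..<d ^ n} \<times> {..<d ^ n}" "y \<in> {..<d ^ n} \<times> {..<d ^ n}"
  shows "(\<Sum>a<d ^ n. \<Sum>b<d ^ n. cnj (basis_weyl n x $$ (b, a)) * basis_weyl n y $$ (b, a)) =
    (if x = y then of_nat (d ^ n) else 0)"
proof -
  obtain P Q P' Q' where xy: "x = (P, Q)" "y = (P', Q')"
      and less: "P < d ^ n" "Q < d ^ n" "P' < d ^ n" "Q' < d ^ n"
    using assms by auto
  let ?F = "\<lambda>k a b. cnj (weyl1 d (int (digit d P k)) (int (digit d Q k)) b a) *
    weyl1 d (int (digit d P' k)) (int (digit d Q' k)) b a"
  have "(\<Sum>a<d ^ n. \<Sum>b<d ^ n. cnj (basis_weyl n x $$ (b, a)) * basis_weyl n y $$ (b, a)) =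
      (\<Sum>a<d ^ n. \<Sum>b<d ^ n. \<Prod>k<n. ?F k (digit d a k) (digit d b k))"
    by (intro sum.cong refl) (simp add: xy basis_weyl_def index_weyl prod.distrib)
  also have "\<dots> = (\<Prod>k<n. \<Sum>a<d. \<Sum>b<d. ?F k a b)" by (rule sum_prod_digits2)
  also have "\<dots> = (\<Prod>k<n. of_nat d * of_bool (digit d P k = digit d P' k \<and> digit d Q k = digit d Q' k))"
    using d by (intro prod.cong refl weyl1_orthogonal) (simp_all add: digit_less)
  also have "\<dots> = of_nat (d ^ n) * of_bool (\<forall>k<n. digit d P k = digit d P' k \<and> digit d Q k = digit d Q' k)"
    by (simp add: prod.distrib prod_of_bool del: of_bool_conj)
  also have "(\<forall>k<n. digit d P k = digit d P' k \<and> digit d Q k = digit d Q' k) \<longleftrightarrow> x = y"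
    using less digit_eq_iff[of P d n P'] digit_eq_iff[of Q d n Q'] by (auto simp: xy)
  finally show ?thesis by simp
qed

text \<open>The tensor power of \<open>weyl1_complete\<close>. It is dual to orthogonality: the sum
  runs over the operators with the matrix positions fixed.\<close>

lemma basis_weyl_complete:
  assumes "a < d ^ n" "b < d ^ n" "i < d ^ n" "j < d ^ n"
  shows "(\<Sum>x\<in>{..<d ^ n} \<times> {..<d ^ n}. basis_weyl n x $$ (b, a) * cnj (basis_weyl n x $$ (j, i))) =
    of_nat (d ^ n) * of_bool (b = j \<and> a = i)"
proof -
  let ?F = "\<lambda>k p q. weyl1 d (int p) (int q) (digit d b k) (digit d a k) *
    cnj (weyl1 d (int p) (int q) (digit d j k) (digit d i k))"
  have "(\<Sum>x\<in>{..<d ^ n} \<times> {..<d ^ n}. basis_weyl n x $$ (b, a) * cnj (basis_weyl n x $$ (j, i))) =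
      (\<Sum>P<d ^ n. \<Sum>Q<d ^ n. \<Prod>k<n. ?F k (digit d P k) (digit d Q k))"
    unfolding sum.cartesian_product' using assms
    by (intro sum.cong refl) (simp add: basis_weyl_def index_weyl prod.distrib)
  also have "\<dots> = (\<Prod>k<n. \<Sum>p<d. \<Sum>q<d. ?F k p q)" by (rule sum_prod_digits2)
  also have "\<dots> = (\<Prod>k<n. of_nat d * of_bool (digit d b k = digit d j k \<and> digit d a k = digit d i k))"
    using d by (intro prod.cong refl weyl1_complete) (simp_all add: digit_less)
  also have "\<dots> = of_nat (d ^ n) * of_bool (\<forall>k<n. digit d b k = digit d j k \<and> digit d a k = digit d i k)"
    by (simp add: prod.distrib prod_of_bool del: of_bool_conj)
  also have "(\<forall>k<n. digit d b k = digit d j k \<and> digit d a k = digit d i k) \<longleftrightarrow> b = j \<and> a = i"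
    using assms digit_eq_iff[of b d n j] digit_eq_iff[of a d n i] by auto
  finally show ?thesis .
qed

text \<open>Fourier inversion for matrices, by completeness after exchanging the sums: the traces
  against the Weyl operators determine every entry.\<close>

lemma basis_weyl_expansion:
  assumes A: "A \<in> carrier_mat (d ^ n) (d ^ n)" and ij: "i < d ^ n" "j < d ^ n"
  shows "(\<Sum>x\<in>{..<d ^ n} \<times> {..<d ^ n}. mtrace (A * basis_weyl n x) * cnj (basis_weyl n x $$ (j, i))) =
    of_nat (d ^ n) * A $$ (i, j)"
proof -
  let ?X = "{..<d ^ n} \<times> {..<d ^ n}" and ?N = "d ^ n"
  have "(\<Sum>x\<in>?X. mtrace (A * basis_weyl n x) * cnj (basis_weyl n x $$ (j, i))) =
      (\<Sum>x\<in>?X. \<Sum>a<?N. \<Sum>b<?N. A $$ (a, b) * (basis_weyl n x $$ (b, a) * cnj (basis_weyl n x $$ (j, i))))"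
    by (simp add: mtrace_mult[OF A basis_weyl_carrier] sum_distrib_right mult.assoc)
  also have "\<dots> = (\<Sum>a<?N. \<Sum>x\<in>?X. \<Sum>b<?N. A $$ (a, b) * (basis_weyl n x $$ (b, a) * cnj (basis_weyl n x $$ (j, i))))"
    by (rule sum.swap)
  also have "\<dots> = (\<Sum>a<?N. \<Sum>b<?N. \<Sum>x\<in>?X. A $$ (a, b) * (basis_weyl n x $$ (b, a) * cnj (basis_weyl n x $$ (j, i))))"
    by (intro sum.cong refl sum.swap)
  also have "\<dots> = (\<Sum>a<?N. \<Sum>b<?N. A $$ (a, b) * (of_nat ?N * of_bool (b = j \<and> a = i)))"
    unfolding sum_distrib_left[symmetric] using ij
    by (intro sum.cong refl) (simp only: basis_weyl_complete lessThan_iff)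
  also have "\<dots> = (\<Sum>a<?N. \<Sum>b<?N. if b = j then if a = i then of_nat ?N * A $$ (i, j) else 0 else 0)"
    by (intro sum.cong refl) auto
  also have "\<dots> = of_nat ?N * A $$ (i, j)" using ij by simp
  finally show ?thesis .
qed

section \<open>The Weyl operators as a nice error basis\<close>

lemma nice_error_basis_weyl:
  "nice_error_basis (d ^ n) ({..<d ^ n} \<times> {..<d ^ n}) (basis_weyl n)"
proof
  let ?X = "{..<d ^ n} \<times> {..<d ^ n}"
  show "finite ?X" "d ^ n > 0" using d by auto
  show "basis_weyl n x \<in> carrier_mat (d ^ n) (d ^ n)" for x by simp
  show "basis_weyl n x * mat_adjoint (basis_weyl n x) = 1\<^sub>m (d ^ n)" for x
    by (simp add: basis_weyl_def weyl_unitary split: prod.split)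
  show "(\<Sum>a<d ^ n. \<Sum>b<d ^ n. cnj (basis_weyl n x $$ (b, a)) * basis_weyl n y $$ (b, a)) =
    (if x = y then of_nat (d ^ n) else 0)" if "x \<in> ?X" "y \<in> ?X" for x y
    using that by (rule basis_weyl_orthogonal)
  show "\<exists>z\<in>?X. \<exists>\<omega>. cmod \<omega> = 1 \<and> basis_weyl n x * basis_weyl n y = \<omega> \<cdot>\<^sub>m basis_weyl n z" for x y
  proof -
    obtain P Q P' Q' where xy: "x = (P, Q)" "y = (P', Q')" by fastforce
    obtain \<omega> p q where \<omega>: "cmod \<omega> = 1" "basis_weyl n x * basis_weyl n y = \<omega> \<cdot>\<^sub>m weyl d n p q"
      using weyl_mult unfolding xy basis_weyl_def prod.case by blast
    moreover obtain z where "z \<in> ?X" "weyl d n p q = basis_weyl n z" using weyl_in_basis by blast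
    ultimately show ?thesis by auto
  qed
  show "\<exists>x\<in>?X. basis_weyl n x = 1\<^sub>m (d ^ n)"
    using weyl_in_basis[of n "\<lambda>_. 0" "\<lambda>_. 0"] by (metis weyl_0)
  show "A = B" if AB: "A \<in> carrier_mat (d ^ n) (d ^ n)" "B \<in> carrier_mat (d ^ n) (d ^ n)"
    and eq: "\<And>x. x \<in> ?X \<Longrightarrow> mtrace (A * basis_weyl n x) = mtrace (B * basis_weyl n x)" for A B
  proof (rule eq_matI)
    fix i j assume "i < dim_row B" "j < dim_col B"
    then have ij: "i < d ^ n" "j < d ^ n" using AB by auto
    have "of_nat (d ^ n) * A $$ (i, j) = of_nat (d ^ n) * B $$ (i, j)"
      unfolding basis_weyl_expansion[OF AB(1) ij, symmetric] basis_weyl_expansion[OF AB(2) ij, symmetric]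
      using eq by (intro sum.cong) auto
    then show "A $$ (i, j) = B $$ (i, j)" using d by simp
  qed (use AB in auto)
qed

text \<open>The definite description is resolved by showing that the explicit mean has the required
  characteristic function and that \<open>separating\<close> leaves no other candidate.\<close>

lemma mean_state_eq:
  "mean_state d n \<rho> = nice_error_basis.mean (d ^ n) ({..<d ^ n} \<times> {..<d ^ n}) (basis_weyl n) \<rho>"
proof -
  interpret nice_error_basis "d ^ n" "{..<d ^ n} \<times> {..<d ^ n}" "basis_weyl n"
    by (rule nice_error_basis_weyl)
  let ?P = "\<lambda>M. M \<in> carrier_mat (d ^ n) (d ^ n) \<and> (\<forall>p q. char_fun d n M p q =
        (if cmod (char_fun d n \<rho> p q) = 1 then char_fun d n \<rho> p q else 0))"
  have mean: "?P (mean \<rho>)"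
  proof (intro conjI allI)
    fix p q :: "nat \<Rightarrow> int"
    \<comment> \<open>Every pair of integer coordinates gives an operator in the finite basis, so
      control over the basis suffices for all \<open>p\<close> and \<open>q\<close>.\<close>
    obtain x where "x \<in> {..<d ^ n} \<times> {..<d ^ n}" "weyl d n (\<lambda>k. - p k) (\<lambda>k. - q k) = basis_weyl n x"
      using weyl_in_basis by blast
    then show "char_fun d n (mean \<rho>) p q =
        (if cmod (char_fun d n \<rho> p q) = 1 then char_fun d n \<rho> p q else 0)"
      by (simp only: char_fun_def mtrace_mean)
  qed simp
  moreover have "M = mean \<rho>" if M: "?P M" for M
  proof (rule separating)
    fix x assume "x \<in> {..<d ^ n} \<times> {..<d ^ n}"
    obtain P Q where x: "x = (P, Q)" by fastforce
    \<comment> \<open>Negated digits undo the sign in \<open>char_fun\<close>, which traces against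
      the Weyl operator at the negated point.\<close>
    have "char_fun d n A (\<lambda>k. - int (digit d P k)) (\<lambda>k. - int (digit d Q k)) = mtrace (A * basis_weyl n x)" for A
      by (simp add: char_fun_def basis_weyl_def x)
    then show "mtrace (M * basis_weyl n x) = mtrace (mean \<rho> * basis_weyl n x)"
      using M mean by metis
  qed (use M in auto)
  ultimately show ?thesis unfolding mean_state_def by (rule the_equality)
qed

end

theorem mainTheorem3:
  fixes d n :: nat and \<rho> :: "complex mat"
  assumes "prime d" and "n \<ge> 1" and "is_state d n \<rho>"
  shows "majorized (spec_vec (mean_state d n \<rho>)) (spec_vec \<rho>) \<and>
         (\<forall>f. schur_concave (d ^ n) f \<longrightarrow> f (spec_vec \<rho>) \<le> f (spec_vec (mean_state d n \<rho>)))"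
proof -
  have d: "d > 0" using assms(1) by (rule prime_gt_0_nat)
  have \<rho>: "density_mat (d ^ n) \<rho>" using assms(3) by (simp add: is_state_iff_density_mat)
  have maj: "majorized (spec_vec (mean_state d n \<rho>)) (spec_vec \<rho>)"
    unfolding mean_state_eq[OF d]
    by (rule nice_error_basis.majorized_mean[OF nice_error_basis_weyl[OF d] \<rho>])
  moreover have "length (spec_vec \<rho>) = d ^ n"
    by (rule length_spec_vec[OF density_matD(1)[OF \<rho>]])
  ultimately show ?thesis by (auto simp: schur_concave_def majorized_def)
qed

end
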